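(* Let $G$ be a solvable group with a purely positive length function. Suppose that $G$ has virtual cohomological dimension $\mathrm{vcd}(G)\leq 3$ and every abelian subgroup of $G$ is finitely generated. Then $G$ contains a finite-index subgroup isomorphic to $\mathbb{Z}^{n}$ for some integer $0\leq n\leq 3$.
   Context: A length function on a group $G$ is a function $l:G\to[0,\infty)$ such that $l(g^{n})=|n|\,l(g)$ for all $g\in G,n\in\mathbb{Z}$; $l(hgh^{-1})=l(g)$ for all $g,h$; and $l(ab)\leq l(a)+l(b)$ whenever $a,b$ commute. It is purely positive if $l(g)>0$ for every element of infinite order. $\mathrm{vcd}(G)$ is the cohomological dimension of a torsion-free finite-index subgroup of $G$. *)

theory Defs
  imports "HOL-Algebra.Algebra" "HOL-Library.Poly_Mapping"
begin

definition infinite_order :: "('g, 'b) monoid_scheme \<Rightarrow> 'g \<Rightarrow> bool" where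
  "infinite_order G g \<longleftrightarrow> (\<forall>n::nat. n > 0 \<longrightarrow> g [^]\<^bsub>G\<^esub> n \<noteq> \<one>\<^bsub>G\<^esub>)"

definition length_function :: "('g, 'b) monoid_scheme \<Rightarrow> ('g \<Rightarrow> real) \<Rightarrow> bool" where
  "length_function G l \<longleftrightarrow>
     (\<forall>g\<in>carrier G. l g \<ge> 0) \<and>
     (\<forall>g\<in>carrier G. \<forall>n::int. l (g [^]\<^bsub>G\<^esub> n) = \<bar>real_of_int n\<bar> * l g) \<and>
     (\<forall>g\<in>carrier G. \<forall>h\<in>carrier G. l (h \<otimes>\<^bsub>G\<^esub> g \<otimes>\<^bsub>G\<^esub> inv\<^bsub>G\<^esub> h) = l g) \<and>
     (\<forall>a\<in>carrier G. \<forall>b\<in>carrier G. a \<otimes>\<^bsub>G\<^esub> b = b \<otimes>\<^bsub>G\<^esub> a \<longrightarrow>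
          l (a \<otimes>\<^bsub>G\<^esub> b) \<le> l a + l b)"

definition purely_positive :: "('g, 'b) monoid_scheme \<Rightarrow> ('g \<Rightarrow> real) \<Rightarrow> bool" where
  "purely_positive G l \<longleftrightarrow> (\<forall>g\<in>carrier G. infinite_order G g \<longrightarrow> l g > 0)"

definition Gmodule :: "('g, 'b) monoid_scheme \<Rightarrow> 'm::ab_group_add set \<Rightarrow> ('g \<Rightarrow> 'm \<Rightarrow> 'm) \<Rightarrow> bool" where
  "Gmodule G M act \<longleftrightarrow>
     0 \<in> M \<and> (\<forall>x\<in>M. \<forall>y\<in>M. x + y \<in> M) \<and> (\<forall>x\<in>M. - x \<in> M) \<and>
     (\<forall>g\<in>carrier G. \<forall>x\<in>M. act g x \<in> M) \<and>
     (\<forall>g\<in>carrier G. \<forall>x\<in>M. \<forall>y\<in>M. act g (x + y) = act g x + act g y) \<and>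
     (\<forall>x\<in>M. act \<one>\<^bsub>G\<^esub> x = x) \<and>
     (\<forall>g\<in>carrier G. \<forall>h\<in>carrier G. \<forall>x\<in>M. act (g \<otimes>\<^bsub>G\<^esub> h) x = act g (act h x))"

definition tuples :: "('g, 'b) monoid_scheme \<Rightarrow> nat \<Rightarrow> 'g list set" where
  "tuples G k = {gs. length gs = k \<and> set gs \<subseteq> carrier G}"

definition cochains :: "('g, 'b) monoid_scheme \<Rightarrow> 'm set \<Rightarrow> nat \<Rightarrow> ('g list \<Rightarrow> 'm) set" where
  "cochains G M k = {f. \<forall>gs\<in>tuples G k. f gs \<in> M}"

definition sgn_pow :: "nat \<Rightarrow> 'm::ab_group_add \<Rightarrow> 'm" where
  "sgn_pow i x = (if even i then x else - x)"

text \<open>Coboundary of a k-cochain, evaluated at a (k+1)-tuple gs = (g_1,...,g_{k+1}):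
  g_1 f(g_2..g_{k+1}) + sum_{i=1}^k (-1)^i f(.., g_i g_{i+1}, ..) + (-1)^{k+1} f(g_1..g_k).\<close>

definition coboundary :: "('g, 'b) monoid_scheme \<Rightarrow> ('g \<Rightarrow> 'm::ab_group_add \<Rightarrow> 'm) \<Rightarrow> nat
     \<Rightarrow> ('g list \<Rightarrow> 'm) \<Rightarrow> 'g list \<Rightarrow> 'm" where
  "coboundary G act k f gs =
     act (gs ! 0) (f (tl gs))
     + (\<Sum>i<k. sgn_pow (Suc i) (f (take i gs @ [gs ! i \<otimes>\<^bsub>G\<^esub> gs ! Suc i] @ drop (Suc (Suc i)) gs)))
     + sgn_pow (Suc k) (f (take k gs))"

definition cohom_vanishes :: "('g, 'b) monoid_scheme \<Rightarrow> 'm::ab_group_add set \<Rightarrow> ('g \<Rightarrow> 'm \<Rightarrow> 'm)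
     \<Rightarrow> nat \<Rightarrow> bool" where
  "cohom_vanishes G M act n \<longleftrightarrow>
     (\<forall>f\<in>cochains G M (Suc n).
        (\<forall>gs\<in>tuples G (Suc (Suc n)). coboundary G act (Suc n) f gs = 0) \<longrightarrow>
        (\<exists>c\<in>cochains G M n. \<forall>gs\<in>tuples G (Suc n). f gs = coboundary G act n c gs))"

text \<open>cd(G) <= n iff H^(n+1)(G, M) = 0 for all ZG-modules M.  Modules are taken with
  underlying group a subgroup of the free abelian group on 'g list (this contains
  the kernels of the bar resolution, which suffice to detect cd).\<close>

definition cd_le :: "('g, 'b) monoid_scheme \<Rightarrow> nat \<Rightarrow> bool" where
  "cd_le G n \<longleftrightarrow>
     (\<forall>(M :: ('g list \<Rightarrow>\<^sub>0 int) set) act. Gmodule G M act \<longrightarrow> cohom_vanishes G M act n)"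

definition torsion_free :: "('g, 'b) monoid_scheme \<Rightarrow> bool" where
  "torsion_free G \<longleftrightarrow> (\<forall>g\<in>carrier G. g \<noteq> \<one>\<^bsub>G\<^esub> \<longrightarrow> infinite_order G g)"

definition vcd_le :: "('g, 'b) monoid_scheme \<Rightarrow> nat \<Rightarrow> bool" where
  "vcd_le G n \<longleftrightarrow>
     (\<exists>H. subgroup H G \<and> finite (rcosets\<^bsub>G\<^esub> H) \<and>
          torsion_free (G\<lparr>carrier := H\<rparr>) \<and> cd_le (G\<lparr>carrier := H\<rparr>) n)"

definition abelian_subgroups_fg :: "('g, 'b) monoid_scheme \<Rightarrow> bool" where
  "abelian_subgroups_fg G \<longleftrightarrow>
     (\<forall>A. subgroup A G \<and> (\<forall>a\<in>A. \<forall>b\<in>A. a \<otimes>\<^bsub>G\<^esub> b = b \<otimes>\<^bsub>G\<^esub> a) \<longrightarrow>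
        (\<exists>S. finite S \<and> S \<subseteq> A \<and> generate G S = A))"

definition Zn_group :: "nat \<Rightarrow> (nat \<Rightarrow> int) monoid" where
  "Zn_group n = \<lparr>carrier = {v. \<forall>i\<ge>n. v i = 0}, monoid.mult = (\<lambda>v w i. v i + w i), monoid.one = (\<lambda>i. 0)\<rparr>"

end

theory Submission
  imports Defs
begin

text \<open>
  The length function is a seminorm on each abelian subgroup, positive off the identity
  but possibly degenerate over the reals. Two consequences drive the proof. First, if
  \<open>x y = d y x\<close> with \<open>d\<close> commuting with \<open>x\<close> and \<open>y\<close>, then \<open>d\<^sup>n y\<close> is conjugate to \<open>y\<close> for every \<open>n\<close>,
  so \<open>l d = 0\<close>: Heisenberg-type commutators vanish. Second, an integral automorphism of rank at
  most three that preserves the seminorm and is congruent to the identity modulo 9 acts trivially: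
  its characteristic polynomial \<open>X\<^sup>3 - t X\<^sup>2 + s X - 1\<close> has \<open>t\<close> and \<open>s\<close> congruent to 3 modulo 9 and
  close in absolute value, whence \<open>s = t\<close>, then \<open>t = 3\<close>, and unipotent isometries are trivial.
  (Rank four fails because of Salem polynomials.) The rank is bounded because \<open>cd \<le> 3\<close> splits the
  third boundary module off the bar resolution, which would kill the nonzero cup product in
  \<open>H\<^sup>4(\<int>\<^sup>4, \<int>)\<close>. Climbing the derived series, the elements that centralize a finite-index
  abelian subgroup \<open>A\<close> of the previous term \<open>D\<close> and act trivially on \<open>D / A\<close> have finite index
  and commute by the first consequence.
\<close>

section \<open>Free abelian groups of finite rank\<close>

lemma carrier_Zn_group: "carrier (Zn_group n) = {v. \<forall>i\<ge>n. v i = 0}"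
  by (simp add: Zn_group_def)

lemma Zn_group_nonzero_index: "v \<in> carrier (Zn_group n) \<Longrightarrow> v i \<noteq> 0 \<Longrightarrow> i < n"
  by (rule ccontr) (simp add: carrier_Zn_group)

lemma mult_Zn_group [simp]: "v \<otimes>\<^bsub>Zn_group n\<^esub> w = (\<lambda>i. v i + w i)"
  by (simp add: Zn_group_def)

lemma one_Zn_group [simp]: "\<one>\<^bsub>Zn_group n\<^esub> = (\<lambda>i. 0)"
  by (simp add: Zn_group_def)

lemma comm_group_Zn_group: "comm_group (Zn_group n)"
proof (rule comm_groupI)
  fix v assume "v \<in> carrier (Zn_group n)"
  then show "\<exists>w\<in>carrier (Zn_group n). w \<otimes>\<^bsub>Zn_group n\<^esub> v = \<one>\<^bsub>Zn_group n\<^esub>"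
    by (intro bexI[of _ "\<lambda>i. - v i"]) (auto simp: carrier_Zn_group)
qed (auto simp: carrier_Zn_group algebra_simps)

lemma group_Zn_group: "group (Zn_group n)"
  using comm_group_Zn_group comm_group.axioms(2) by blast

lemma inv_Zn_group:
  assumes "v \<in> carrier (Zn_group n)"
  shows "inv\<^bsub>Zn_group n\<^esub> v = (\<lambda>i. - v i)"
proof -
  interpret group "Zn_group n" by (rule group_Zn_group)
  show ?thesis
    by (rule inv_equality) (use assms in \<open>auto simp: carrier_Zn_group\<close>)
qed

lemma int_pow_Zn_group:
  assumes "v \<in> carrier (Zn_group n)"
  shows "v [^]\<^bsub>Zn_group n\<^esub> (k::int) = (\<lambda>i. k * v i)"
proof -
  interpret group "Zn_group n" by (rule group_Zn_group)
  have nat: "v [^]\<^bsub>Zn_group n\<^esub> (m::nat) = (\<lambda>i. int m * v i)" for m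
    by (induction m) (auto simp: algebra_simps)
  show ?thesis
  proof (cases "k \<ge> 0")
    case True
    then obtain m where "k = int m" using nonneg_int_cases by blast
    then show ?thesis using nat[of m] by (simp add: int_pow_int)
  next
    case False
    then obtain m where m: "k = - int m" by (metis int_cases2 of_nat_0_le_iff)
    have "(\<lambda>i. int m * v i) \<in> carrier (Zn_group n)" using assms by (auto simp: carrier_Zn_group)
    then show ?thesis using nat[of m] assms m by (simp add: int_pow_neg int_pow_int inv_Zn_group)
  qed
qed

definition unit_vec :: "nat \<Rightarrow> nat \<Rightarrow> int" where
  "unit_vec i = (\<lambda>j. if j = i then 1 else 0)"

lemma unit_vec_in_Zn_group: "i < n \<Longrightarrow> unit_vec i \<in> carrier (Zn_group n)"
  by (auto simp: carrier_Zn_group unit_vec_def)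

section \<open>Freeness of finitely generated torsion-free abelian groups\<close>

context comm_group
begin

lemma finite_imp_Zn_hom_covers:
  assumes "finite S" "S \<subseteq> carrier G"
  shows "\<exists>n. \<exists>F\<in>hom (Zn_group n) G. S \<subseteq> F ` carrier (Zn_group n)"
  using assms
proof (induction S)
  case empty
  have "(\<lambda>v. \<one>) \<in> hom (Zn_group 0) G" by (auto simp: hom_def)
  then show ?case by blast
next
  case (insert s S)
  then obtain n F where F: "F \<in> hom (Zn_group n) G" and S: "S \<subseteq> F ` carrier (Zn_group n)" by auto
  have s: "s \<in> carrier G" using insert by simp
  have Fc: "F v \<in> carrier G" if "v \<in> carrier (Zn_group n)" for v using F that by (auto simp: hom_def)
  \<comment> \<open>Coordinate \<open>n\<close> is the new one and will carry the exponent of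
    \<open>s\<close>; \<open>p\<close> erases it so that the old \<open>F\<close> applies.\<close>
  define p where "p v = v(n := 0)" for v :: "nat \<Rightarrow> int"
  have p: "p v \<in> carrier (Zn_group n)" if "v \<in> carrier (Zn_group (Suc n))" for v
    using that by (auto simp: carrier_Zn_group p_def)
  define F' where "F' v = F (p v) \<otimes> s [^] v n" for v
  have "F' \<in> hom (Zn_group (Suc n)) G"
  proof (rule homI)
    fix v w assume v: "v \<in> carrier (Zn_group (Suc n))" and w: "w \<in> carrier (Zn_group (Suc n))"
    have "p (\<lambda>i. v i + w i) = (\<lambda>i. p v i + p w i)" by (auto simp: p_def)
    then have "F (p (\<lambda>i. v i + w i)) = F (p v) \<otimes> F (p w)"
      using hom_mult[OF F p[OF v] p[OF w]] by simp
    then show "F' (v \<otimes>\<^bsub>Zn_group (Suc n)\<^esub> w) = F' v \<otimes> F' w"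
      using s Fc[OF p[OF v]] Fc[OF p[OF w]] by (simp add: F'_def m_ac flip: int_pow_mult)
  qed (use s Fc p in \<open>auto simp: F'_def\<close>)
  moreover have "S \<subseteq> F' ` carrier (Zn_group (Suc n))"
  proof
    fix x assume "x \<in> S"
    then obtain v where v: "v \<in> carrier (Zn_group n)" "x = F v" using S by auto
    then have "p v = v" "v n = 0" by (auto simp: p_def carrier_Zn_group)
    moreover have "v \<in> carrier (Zn_group (Suc n))" using v by (auto simp: carrier_Zn_group)
    ultimately show "x \<in> F' ` carrier (Zn_group (Suc n))"
      using v Fc[OF v(1)] by (intro image_eqI[of _ _ v]) (auto simp: F'_def)
  qed
  moreover have "s \<in> F' ` carrier (Zn_group (Suc n))"
  proof (rule image_eqI)
    have "p (unit_vec n) = (\<lambda>i. 0)" by (auto simp: p_def unit_vec_def)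
    moreover have "F (\<lambda>i. 0) = \<one>" using hom_one[OF F group_Zn_group is_group] by simp
    ultimately show "s = F' (unit_vec n)"
      using s by (simp add: F'_def) (simp add: unit_vec_def)
  qed (simp add: unit_vec_in_Zn_group)
  ultimately show ?case by blast
qed

text \<open>A relation supported on one coordinate gives the image of that basis vector finite
  order. Torsion-freeness makes this image trivial, so the vector is redundant as a
  generator.\<close>

lemma Zn_epi_drop:
  assumes tf: "torsion_free G" and F: "F \<in> hom (Zn_group n) G"
    and surj: "F ` carrier (Zn_group n) = carrier G"
    and v: "v \<in> carrier (Zn_group n)" "v i \<noteq> 0" "\<And>j. j \<noteq> i \<Longrightarrow> v j = 0" and Fv: "F v = \<one>"
  shows "\<exists>F'\<in>hom (Zn_group (n - 1)) G. F' ` carrier (Zn_group (n - 1)) = carrier G"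
proof -
  have i: "i < n" using Zn_group_nonzero_index[OF v(1,2)] .
  have u: "unit_vec i \<in> carrier (Zn_group n)" using i by (rule unit_vec_in_Zn_group)
  have Fu: "F (unit_vec i) \<in> carrier G" using F u by (auto simp: hom_def)
  have pow: "F (\<lambda>j. k * unit_vec i j) = F (unit_vec i) [^] k" for k :: int
    using hom_int_pow[OF F u group_Zn_group is_group, of k] int_pow_Zn_group[OF u] by simp
  have "v = (\<lambda>j. v i * unit_vec i j)" using v(3) by (auto simp: unit_vec_def)
  then have vi: "F (unit_vec i) [^] (v i) = \<one>" using pow[of "v i"] Fv by metis
  have "F (unit_vec i) [^] \<bar>v i\<bar> = \<one>"
    using vi Fu by (auto simp: abs_if int_pow_neg)
  then have "F (unit_vec i) [^] nat \<bar>v i\<bar> = \<one>"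
    by (metis abs_ge_zero int_nat_eq int_pow_int)
  then have "\<not> infinite_order G (F (unit_vec i))"
    using v(2) unfolding infinite_order_def by (metis abs_eq_0 nat_0_iff gr0I abs_ge_zero eq_iff)
  then have one: "F (unit_vec i) = \<one>" using tf Fu by (auto simp: torsion_free_def)
  \<comment> \<open>The transposition of \<open>i\<close> and \<open>n - 1\<close> moves the
    redundant coordinate to the end, where \<open>Zn_group (n - 1)\<close> leaves it out.\<close>
  define \<sigma> where "\<sigma> j = (if j = i then n - 1 else if j = n - 1 then i else j)" for j
  have \<sigma>\<sigma>: "\<sigma> (\<sigma> j) = j" for j by (auto simp: \<sigma>_def)
  define F' where "F' w = F (\<lambda>j. w (\<sigma> j))" for w
  have \<sigma>Z: "(\<lambda>j. w (\<sigma> j)) \<in> carrier (Zn_group n)" if "w \<in> carrier (Zn_group (n - 1))" for w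
    using that i by (auto simp: carrier_Zn_group \<sigma>_def)
  have F'c: "F' w \<in> carrier G" if "w \<in> carrier (Zn_group (n - 1))" for w
    using hom_in_carrier[OF F \<sigma>Z[OF that]] by (simp add: F'_def)
  have "F' \<in> hom (Zn_group (n - 1)) G"
  proof (rule homI)
    fix w w' assume "w \<in> carrier (Zn_group (n - 1))" "w' \<in> carrier (Zn_group (n - 1))"
    then show "F' (w \<otimes>\<^bsub>Zn_group (n - 1)\<^esub> w') = F' w \<otimes> F' w'"
      using hom_mult[OF F \<sigma>Z \<sigma>Z, of w w'] by (simp add: F'_def)
  qed (rule F'c)
  moreover have "carrier G \<subseteq> F' ` carrier (Zn_group (n - 1))"
  proof
    fix g assume "g \<in> carrier G"
    then obtain w where w: "w \<in> carrier (Zn_group n)" "g = F w" using surj by auto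
    let ?w = "w(i := 0)"
    have w': "?w \<in> carrier (Zn_group n)" "(\<lambda>j. w i * unit_vec i j) \<in> carrier (Zn_group n)"
      using w i by (auto simp: carrier_Zn_group unit_vec_def)
    have "w = (\<lambda>j. ?w j + w i * unit_vec i j)" by (auto simp: unit_vec_def)
    then have "g = F ?w \<otimes> F (\<lambda>j. w i * unit_vec i j)"
      using w(2) hom_mult[OF F w'] by simp
    then have "g = F ?w" using pow[of "w i"] one hom_in_carrier[OF F w'(1)] by simp
    moreover have "F ?w = F' (\<lambda>j. ?w (\<sigma> j))" by (simp only: F'_def \<sigma>\<sigma>)
    moreover have "(\<lambda>j. ?w (\<sigma> j)) \<in> carrier (Zn_group (n - 1))"
      using w(1) i by (auto simp: carrier_Zn_group \<sigma>_def)
    ultimately show "g \<in> F' ` carrier (Zn_group (n - 1))" by blast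
  qed
  ultimately show ?thesis using F'c by blast
qed

text \<open>Euclid's algorithm on the entries of the relation \<open>v\<close>: elementary changes
  of basis lower the sum of their absolute values until a single entry survives, which is the case
  of \<open>Zn_epi_drop\<close>.\<close>

lemma Zn_epi_reduce:
  assumes tf: "torsion_free G" and "F \<in> hom (Zn_group n) G"
    and "F ` carrier (Zn_group n) = carrier G"
    and "v \<in> carrier (Zn_group n)" "v \<noteq> (\<lambda>i. 0)" "F v = \<one>"
  shows "\<exists>F'\<in>hom (Zn_group (n - 1)) G. F' ` carrier (Zn_group (n - 1)) = carrier G"
  using assms(2-)
proof (induction "\<Sum>i<n. nat \<bar>v i\<bar>" arbitrary: v F rule: less_induct)
  case less
  note F = \<open>F \<in> hom (Zn_group n) G\<close> and v = \<open>v \<in> carrier (Zn_group n)\<close>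
  obtain i where i: "v i \<noteq> 0" using less.prems(4) by auto
  show ?case
  proof (cases "\<exists>j. j \<noteq> i \<and> v j \<noteq> 0")
    case False
    then show ?thesis using Zn_epi_drop[OF tf F less.prems(2) v i] less.prems(5) by blast
  next
    case True
    then obtain k where k: "k \<noteq> i" "v k \<noteq> 0" by blast
    obtain i j where ij: "i \<noteq> j" "v i \<noteq> 0" "v j \<noteq> 0" "\<bar>v j\<bar> \<le> \<bar>v i\<bar>"
    proof (cases "\<bar>v k\<bar> \<le> \<bar>v i\<bar>")
      case True
      then show thesis using that[of i k] i k by simp
    next
      case False
      then show thesis using that[of k i] i k by simp
    qed
    have lt: "i < n" "j < n" using ij Zn_group_nonzero_index[OF v] by simp_all
    \<comment> \<open>With this sign, subtracting \<open>s * v j\<close> from \<open>v i\<close>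
      shortens it by exactly the absolute value of \<open>v j\<close>.\<close>
    define s where "s = sgn (v i) * sgn (v j)"
    define T where "T k w = w(i := w i + k * w j)" for k :: int and w :: "nat \<Rightarrow> int"
    have TZ: "T k w \<in> carrier (Zn_group n)" if "w \<in> carrier (Zn_group n)" for k w
      using that lt by (auto simp: carrier_Zn_group T_def)
    have TT: "T k (T (- k) w) = w" for k w using ij(1) by (auto simp: T_def)
    \<comment> \<open>The relation is moved by \<open>T (- s)\<close>, so \<open>F\<close> is
      precomposed with the inverse \<open>T s\<close> and still kills the new relation.\<close>
    have "(\<lambda>w. F (T s w)) \<in> hom (Zn_group n) G"
    proof (rule homI)
      fix w w' assume w: "w \<in> carrier (Zn_group n)" "w' \<in> carrier (Zn_group n)"
      have "T s (\<lambda>i. w i + w' i) = (\<lambda>i. T s w i + T s w' i)"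
        by (auto simp: T_def algebra_simps)
      then show "F (T s (w \<otimes>\<^bsub>Zn_group n\<^esub> w')) = F (T s w) \<otimes> F (T s w')"
        using hom_mult[OF F TZ[OF w(1)] TZ[OF w(2)]] by simp
    qed (use hom_in_carrier[OF F] TZ in blast)
    moreover have "(\<lambda>w. F (T s w)) ` carrier (Zn_group n) = carrier G"
    proof -
      have "T s ` carrier (Zn_group n) = carrier (Zn_group n)"
      proof
        show "carrier (Zn_group n) \<subseteq> T s ` carrier (Zn_group n)"
        proof
          fix w assume "w \<in> carrier (Zn_group n)"
          then show "w \<in> T s ` carrier (Zn_group n)"
            using TZ[of w "- s"] by (intro image_eqI[of _ _ "T (- s) w"]) (simp_all add: TT)
        qed
      qed (auto intro: TZ)
      moreover have "(\<lambda>w. F (T s w)) ` carrier (Zn_group n) = F ` T s ` carrier (Zn_group n)"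
        by (simp only: image_image)
      ultimately show ?thesis using less.prems(2) by simp
    qed
    moreover have "T (- s) v \<noteq> (\<lambda>i. 0)"
    proof
      assume "T (- s) v = (\<lambda>i. 0)"
      then have "T (- s) v j = 0" by simp
      then show False using ij by (simp add: T_def)
    qed
    moreover have "F (T s (T (- s) v)) = \<one>" unfolding TT by (rule less.prems(5))
    moreover have "(\<Sum>k<n. nat \<bar>T (- s) v k\<bar>) < (\<Sum>k<n. nat \<bar>v k\<bar>)"
    proof (rule sum_strict_mono_ex1)
      have *: "\<bar>v i - s * v j\<bar> < \<bar>v i\<bar>"
      proof -
        have "v i - s * v j = sgn (v i) * (\<bar>v i\<bar> - \<bar>v j\<bar>)"
          by (simp add: s_def right_diff_distrib mult_sgn_abs mult.assoc) (simp add: abs_sgn mult.commute)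
        then show ?thesis using ij by (simp add: abs_mult abs_sgn_eq)
      qed
      then show "\<exists>k\<in>{..<n}. nat \<bar>T (- s) v k\<bar> < nat \<bar>v k\<bar>"
        using lt by (intro bexI[of _ i]) (auto simp: T_def)
      show "\<forall>k\<in>{..<n}. nat \<bar>T (- s) v k\<bar> \<le> nat \<bar>v k\<bar>"
        using * by (auto simp: T_def)
    qed simp
    ultimately show ?thesis using less.hyps[of "T (- s) v" "\<lambda>w. F (T s w)"] TZ[OF v] by blast
  qed
qed

text \<open>An epimorphism from a \<open>Zn_group\<close> of least rank is injective, because a
  nonzero kernel vector would let \<open>Zn_epi_reduce\<close> lower the rank.\<close>

lemma fg_torsion_free_iso_Zn:
  assumes tf: "torsion_free G" and S: "finite S" "S \<subseteq> carrier G" "generate G S = carrier G"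
  shows "\<exists>n. \<exists>F. F \<in> iso (Zn_group n) G"
proof -
  let ?P = "\<lambda>n. \<exists>F\<in>hom (Zn_group n) G. F ` carrier (Zn_group n) = carrier G"
  have "\<exists>n. ?P n"
  proof -
    obtain n F where F: "F \<in> hom (Zn_group n) G" and "S \<subseteq> F ` carrier (Zn_group n)"
      using finite_imp_Zn_hom_covers[OF S(1,2)] by blast
    moreover have "subgroup (F ` carrier (Zn_group n)) G"
      using group_hom.img_is_subgroup[of "Zn_group n" G F] F group_Zn_group is_group
      by (simp add: group_hom_def group_hom_axioms_def)
    ultimately have "carrier G \<subseteq> F ` carrier (Zn_group n)"
      using generate_subgroup_incl S(3) by metis
    then show ?thesis using F by (auto simp: hom_def intro!: exI[of _ n])
  qed
  then obtain n where n: "?P n" and least: "\<And>m. ?P m \<Longrightarrow> n \<le> m"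
    using LeastI_ex[of ?P] Least_le[of ?P] by blast
  from n obtain F where F: "F \<in> hom (Zn_group n) G" and surj: "F ` carrier (Zn_group n) = carrier G" by blast
  interpret F: group_hom "Zn_group n" G F
    using F group_Zn_group is_group by (simp add: group_hom_def group_hom_axioms_def)
  have "inj_on F (carrier (Zn_group n))"
    unfolding F.inj_on_one_iff
  proof (intro allI impI)
    fix v assume v: "v \<in> carrier (Zn_group n)" "F v = \<one>"
    show "v = \<one>\<^bsub>Zn_group n\<^esub>"
    proof (rule ccontr)
      assume nz: "v \<noteq> \<one>\<^bsub>Zn_group n\<^esub>"
      \<comment> \<open>Subtraction is truncated, so this is consistent for \<open>n = 0\<close>;
        there the contradiction comes from the zero vector being the only element.\<close>
      then have "n \<le> n - 1"
        using Zn_epi_reduce[OF tf F surj v(1)] v(2) least by simp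
      then have "n = 0" by simp
      then show False using v nz by (auto simp: carrier_Zn_group)
    qed
  qed
  then show ?thesis using F surj unfolding iso_def bij_betw_def by blast
qed

end

section \<open>Cohomological dimension and free abelian subgroups\<close>

lemma sgn_pow_simps [simp]: "sgn_pow 0 x = x" "sgn_pow (Suc i) x = - sgn_pow i x"
  by (simp_all add: sgn_pow_def)

lemma coboundary_three:
  "coboundary G act 3 f [a,b,c,d] = act a (f [b,c,d]) - f [a \<otimes>\<^bsub>G\<^esub> b, c, d] + f [a, b \<otimes>\<^bsub>G\<^esub> c, d]
     - f [a, b, c \<otimes>\<^bsub>G\<^esub> d] + f [a,b,c]"
  by (simp add: coboundary_def eval_nat_numeral)

lemma coboundary_four:
  "coboundary G act 4 f [a,b,c,d,e] = act a (f [b,c,d,e]) - f [a \<otimes>\<^bsub>G\<^esub> b, c, d, e]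
     + f [a, b \<otimes>\<^bsub>G\<^esub> c, d, e] - f [a, b, c \<otimes>\<^bsub>G\<^esub> d, e] + f [a, b, c, d \<otimes>\<^bsub>G\<^esub> e] - f [a,b,c,d]"
  by (simp add: coboundary_def eval_nat_numeral)

text \<open>The alternating sum over the permutations of a basis kills every coboundary.\<close>

lemma cup_product_not_coboundary:
  fixes \<gamma> :: "(nat \<Rightarrow> int) \<Rightarrow> (nat \<Rightarrow> int) \<Rightarrow> (nat \<Rightarrow> int) \<Rightarrow> int"
  assumes eq: "\<And>a b c d. \<lbrakk>a \<in> carrier (Zn_group 4); b \<in> carrier (Zn_group 4);
                 c \<in> carrier (Zn_group 4); d \<in> carrier (Zn_group 4)\<rbrakk> \<Longrightarrow>
      a 0 * b 1 * c 2 * d 3 = \<gamma> b c d - \<gamma> (\<lambda>i. a i + b i) c d + \<gamma> a (\<lambda>i. b i + c i) d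
        - \<gamma> a b (\<lambda>i. c i + d i) + \<gamma> a b c"
  shows False
proof -
  define u where "u = unit_vec"
  define p where "p i j = (\<lambda>k. u i k + u j k)" for i j
  define T where "T i j k = \<gamma> (u i) (u j) (u k)" for i j k
  \<comment> \<open>\<open>P\<close>, \<open>Q\<close> and \<open>R\<close> are the terms with a sum
    in the first, second or third argument. Each is symmetric in the two summands, so it cancels
    against the permutation that swaps them.\<close>
  define P where "P i j k l = \<gamma> (p i j) (u k) (u l)" for i j k l
  define Q where "Q i j k l = \<gamma> (u i) (p j k) (u l)" for i j k l
  define R where "R i j k l = \<gamma> (u i) (u j) (p k l)" for i j k l
  have p: "p i j = p j i" for i j by (auto simp: p_def)
  have sw: "P i j k l = P j i k l" "Q i j k l = Q i k j l" "R i j k l = R i j l k" for i j k l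
    by (simp_all add: P_def Q_def R_def p[of i j] p[of j k] p[of k l])
  have e: "(if i = 0 \<and> j = 1 \<and> k = 2 \<and> l = 3 then 1 else 0) =
     T j k l - P i j k l + Q i j k l - R i j k l + T i j k"
    if "i < 4" "j < 4" "k < 4" "l < 4" for i j k l
  proof -
    have "u i 0 * u j 1 * u k 2 * u l 3 = (if i = 0 \<and> j = 1 \<and> k = 2 \<and> l = 3 then 1 else 0)"
      by (simp add: u_def unit_vec_def)
    then show ?thesis
      using eq[of "u i" "u j" "u k" "u l"] that
      by (simp add: T_def P_def Q_def R_def p_def u_def unit_vec_in_Zn_group)
  qed
  note sw' = sw(1)[of 1 0] sw(1)[of 2 0] sw(1)[of 3 0] sw(1)[of 2 1] sw(1)[of 3 1] sw(1)[of 3 2]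
     sw(2)[of _ 1 0] sw(2)[of _ 2 0] sw(2)[of _ 3 0] sw(2)[of _ 2 1] sw(2)[of _ 3 1] sw(2)[of _ 3 2]
     sw(3)[of _ _ 1 0] sw(3)[of _ _ 2 0] sw(3)[of _ _ 3 0] sw(3)[of _ _ 2 1] sw(3)[of _ _ 3 1] sw(3)[of _ _ 3 2]
  \<comment> \<open>All 24 permutations of the basis. The \<open>T\<close> terms cancel in the
    alternating sum because rotating four indices is an odd permutation; on the left only the
    identity contributes, which leaves 1 = 0.\<close>
  note es = e[of 0 1 2 3] e[of 0 1 3 2] e[of 0 2 1 3] e[of 0 2 3 1] e[of 0 3 1 2] e[of 0 3 2 1]
     e[of 1 0 2 3] e[of 1 0 3 2] e[of 1 2 0 3] e[of 1 2 3 0] e[of 1 3 0 2] e[of 1 3 2 0]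
     e[of 2 0 1 3] e[of 2 0 3 1] e[of 2 1 0 3] e[of 2 1 3 0] e[of 2 3 0 1] e[of 2 3 1 0]
     e[of 3 0 1 2] e[of 3 0 2 1] e[of 3 1 0 2] e[of 3 1 2 0] e[of 3 2 0 1] e[of 3 2 1 0]
  show False
    using es[simplified, unfolded sw'[simplified]] by linarith
qed

section \<open>Equivariant coordinates and the bar resolution\<close>

context group
begin

text \<open>Left translation through the injective \<open>e\<close> is a free action. After one
  representative is chosen in each orbit, the displacement from it is an equivariant map
  \<open>r\<close>, which serves to pull cochains on the free abelian group back to
  \<open>G\<close>.\<close>

lemma left_coset_coordinates:
  assumes e: "e \<in> hom (Zn_group n) G" and inj: "inj_on e (carrier (Zn_group n))"
  obtains r :: "'a \<Rightarrow> nat \<Rightarrow> int"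
  where "\<And>v h. \<lbrakk>v \<in> carrier (Zn_group n); h \<in> carrier G\<rbrakk> \<Longrightarrow> r (e v \<otimes> h) = (\<lambda>i. v i + r h i)"
proof -
  let ?Z = "carrier (Zn_group n)"
  have ec: "e v \<in> carrier G" if "v \<in> ?Z" for v using e that by (auto simp: hom_def)
  have ea: "e (\<lambda>i. v i + w i) = e v \<otimes> e w" if "v \<in> ?Z" "w \<in> ?Z" for v w
    using hom_mult[OF e that] by simp
  have add: "(\<lambda>i. v i + w i) \<in> ?Z" if "v \<in> ?Z" "w \<in> ?Z" for v w using that by (auto simp: carrier_Zn_group)
  have e0: "e (\<lambda>i. 0) = \<one>"
    using hom_one[OF e group_Zn_group is_group] by simp
  have zero: "(\<lambda>i. 0) \<in> ?Z" by (auto simp: carrier_Zn_group)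
  define orb where "orb h = {e v \<otimes> h | v. v \<in> ?Z}" for h
  define t where "t h = (SOME x. x \<in> orb h)" for h
  have orb: "orb (e v \<otimes> h) = orb h" if v: "v \<in> ?Z" and h: "h \<in> carrier G" for v h
  proof -
    have neg: "(\<lambda>i. w i - v i) \<in> ?Z" if "w \<in> ?Z" for w using that v by (auto simp: carrier_Zn_group)
    show ?thesis
    proof (auto simp: orb_def)
      fix w assume w: "w \<in> ?Z"
      show "\<exists>v'. e w \<otimes> (e v \<otimes> h) = e v' \<otimes> h \<and> v' \<in> ?Z"
        using ea[OF w v] add[OF w v] ec[OF w] ec[OF v] h m_assoc by metis
      have "e w = e (\<lambda>i. w i - v i) \<otimes> e v" using ea[OF neg[OF w] v] by simp
      then show "\<exists>v'. e w \<otimes> h = e v' \<otimes> (e v \<otimes> h) \<and> v' \<in> ?Z"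
        using neg[OF w] ec[OF neg[OF w]] ec[OF v] h m_assoc by metis
    qed
  qed
  have "\<exists>v\<in>?Z. h = e v \<otimes> t h" if h: "h \<in> carrier G" for h
  proof -
    have "h \<in> orb h" using zero e0 h unfolding orb_def by force
    then have "t h \<in> orb h" unfolding t_def by (rule someI)
    then obtain v where v: "v \<in> ?Z" "t h = e v \<otimes> h" by (auto simp: orb_def)
    have n: "(\<lambda>i. - v i) \<in> ?Z" using v by (auto simp: carrier_Zn_group)
    have "e (\<lambda>i. - v i) \<otimes> e v = \<one>" using ea[OF n v(1)] e0 by simp
    then have "e (\<lambda>i. - v i) \<otimes> t h = h" using v ec[OF n] ec[OF v(1)] h by (simp add: m_assoc[symmetric])
    then show ?thesis using n by metis
  qed
  then obtain r where r: "\<And>h. h \<in> carrier G \<Longrightarrow> r h \<in> ?Z \<and> h = e (r h) \<otimes> t h" by metis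
  have tc: "t h \<in> carrier G" if "h \<in> carrier G" for h
  proof -
    have "h \<in> orb h" using zero e0 that unfolding orb_def by force
    then have "t h \<in> orb h" unfolding t_def by (rule someI)
    then show ?thesis using that ec by (auto simp: orb_def)
  qed
  show ?thesis
  proof
    fix v h assume v: "v \<in> ?Z" and h: "h \<in> carrier G"
    let ?g = "e v \<otimes> h"
    have g: "?g \<in> carrier G" using ec[OF v] h by simp
    have tt: "t ?g = t h" using orb[OF v h] by (simp add: t_def)
    have "e (r ?g) \<otimes> t h = e v \<otimes> (e (r h) \<otimes> t h)" using r[OF g] r[OF h] tt by metis
    also have "\<dots> = e (\<lambda>i. v i + r h i) \<otimes> t h"
      using ea[OF v, of "r h"] r[OF h] ec[OF v] ec tc[OF h] by (simp add: m_assoc)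
    finally have "e (r ?g) = e (\<lambda>i. v i + r h i)"
      using tc[OF h] r[OF g] r[OF h] ec add[OF v] by simp
    then show "r ?g = (\<lambda>i. v i + r h i)" using inj r[OF g] r[OF h] add[OF v] by (simp add: inj_on_def)
  qed
qed

text \<open>Homogeneous bar resolution: a list \<open>[h0, \<dots>, hk]\<close> is a generator in degree \<open>k\<close>, with
  diagonal group action.\<close>

definition bar_shift :: "'a \<Rightarrow> ('a list \<Rightarrow>\<^sub>0 int) \<Rightarrow> ('a list \<Rightarrow>\<^sub>0 int)" where
  "bar_shift g = frag_extend (frag_of \<circ> map (\<lambda>x. g \<otimes> x))"

lemma bar_shift_simps [simp]:
  "bar_shift g (frag_of xs) = frag_of (map (\<lambda>x. g \<otimes> x) xs)"
  "bar_shift g 0 = 0"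
  "bar_shift g (a + b) = bar_shift g a + bar_shift g b"
  "bar_shift g (a - b) = bar_shift g a - bar_shift g b"
  "bar_shift g (- a) = - bar_shift g a"
  by (simp_all add: bar_shift_def frag_extend_add frag_extend_diff frag_extend_minus)

lemma keys_bar_shift:
  assumes "Poly_Mapping.keys m \<subseteq> lists (carrier G)" "g \<in> carrier G"
  shows "Poly_Mapping.keys (bar_shift g m) \<subseteq> lists (carrier G)"
  unfolding bar_shift_def
  by (rule order_trans[OF keys_frag_extend]) (use assms in \<open>auto simp: subset_iff in_lists_conv_set split: if_splits\<close>)

lemma bar_shift_one:
  assumes "Poly_Mapping.keys m \<subseteq> lists (carrier G)"
  shows "bar_shift \<one> m = m"
proof -
  have "bar_shift \<one> m = frag_extend frag_of m"
    unfolding bar_shift_def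
  proof (rule frag_extend_eq)
    fix xs assume "xs \<in> Poly_Mapping.keys m"
    then have "set xs \<subseteq> carrier G" using assms by auto
    then have "map (\<lambda>x. \<one> \<otimes> x) xs = xs" by (intro map_idI) auto
    then show "(frag_of \<circ> map (\<lambda>x. \<one> \<otimes> x)) xs = frag_of xs" by simp
  qed
  then show ?thesis using frag_expansion[of m] by simp
qed

lemma bar_shift_mult:
  assumes "Poly_Mapping.keys m \<subseteq> lists (carrier G)" "g \<in> carrier G" "h \<in> carrier G"
  shows "bar_shift (g \<otimes> h) m = bar_shift g (bar_shift h m)"
proof -
  have "bar_shift g (bar_shift h m) = frag_extend ((frag_of \<circ> map (\<lambda>x. g \<otimes> x)) \<circ> map (\<lambda>x. h \<otimes> x)) m"
    unfolding bar_shift_def by (rule frag_extend_compose)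
  also have "\<dots> = bar_shift (g \<otimes> h) m"
    unfolding bar_shift_def
  proof (rule frag_extend_eq)
    fix xs assume "xs \<in> Poly_Mapping.keys m"
    then have "set xs \<subseteq> carrier G" using assms by auto
    then have "map (\<lambda>x. g \<otimes> (h \<otimes> x)) xs = map (\<lambda>x. (g \<otimes> h) \<otimes> x) xs"
      using assms by (intro map_cong) (auto simp: m_assoc)
    then show "((frag_of \<circ> map (\<lambda>x. g \<otimes> x)) \<circ> map (\<lambda>x. h \<otimes> x)) xs = (frag_of \<circ> map (\<lambda>x. (g \<otimes> h) \<otimes> x)) xs"
      by (simp only: comp_def map_map)
  qed
  finally show ?thesis by simp
qed

definition bar_boundary :: "'a \<Rightarrow> 'a \<Rightarrow> 'a \<Rightarrow> 'a \<Rightarrow> 'a \<Rightarrow> ('a list \<Rightarrow>\<^sub>0 int)" where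
  "bar_boundary a b c d e = frag_of [b,c,d,e] - frag_of [a,c,d,e] + frag_of [a,b,d,e]
      - frag_of [a,b,c,e] + frag_of [a,b,c,d]"

lemma bar_shift_boundary:
  "bar_shift g (bar_boundary a b c d e) =
    bar_boundary (g \<otimes> a) (g \<otimes> b) (g \<otimes> c) (g \<otimes> d) (g \<otimes> e)"
  by (simp add: bar_boundary_def)

lemma bar_boundary_boundary:
  "bar_boundary b c d e f - bar_boundary a c d e f + bar_boundary a b d e f
    - bar_boundary a b c e f + bar_boundary a b c d f - bar_boundary a b c d e = 0"
  by (simp add: bar_boundary_def)

text \<open>The universal 4-cocycle: the boundary of the homogeneous cell belonging to the
  bar symbol \<open>[g1 | g2 | g3 | g4]\<close>.\<close>

definition bar_cocycle :: "'a list \<Rightarrow> ('a list \<Rightarrow>\<^sub>0 int)" where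
  "bar_cocycle gs = bar_boundary \<one> (gs ! 0) (gs ! 0 \<otimes> gs ! 1) (gs ! 0 \<otimes> gs ! 1 \<otimes> gs ! 2)
      (gs ! 0 \<otimes> gs ! 1 \<otimes> gs ! 2 \<otimes> gs ! 3)"

text \<open>The six terms are the boundaries of the faces of the 5-simplex whose vertices are the
  partial products of the list, starting with \<open>\<one>\<close>; they cancel because the
  boundary of a boundary is zero.\<close>

lemma coboundary_bar_cocycle:
  assumes "gs \<in> tuples G 5"
  shows "coboundary G bar_shift 4 bar_cocycle gs = 0"
proof -
  obtain a b c d e where gs: "gs = [a,b,c,d,e]"
    using assms by (auto simp: tuples_def length_Suc_conv numeral_eq_Suc)
  have c: "a \<in> carrier G" "b \<in> carrier G" "c \<in> carrier G" "d \<in> carrier G" "e \<in> carrier G"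
    using assms by (auto simp: gs tuples_def)
  show ?thesis
    using bar_boundary_boundary[of a "a \<otimes> b" "a \<otimes> b \<otimes> c" "a \<otimes> b \<otimes> c \<otimes> d" "a \<otimes> b \<otimes> c \<otimes> d \<otimes> e" \<one>] c
    by (simp add: gs coboundary_four bar_cocycle_def bar_shift_boundary m_assoc algebra_simps)
qed

text \<open>The bound makes the universal cocycle the coboundary of a cochain \<open>c\<close> with
  values in a module \<open>M\<close>. A functional on \<open>M\<close> that is invariant under the
  copy of Z^4 turns \<open>c\<close> into an integral cochain on Z^4 whose coboundary is the cup
  product of the coordinates, against \<open>cup_product_not_coboundary\<close>.\<close>

lemma cd_le_three_imp_no_Z4:
  assumes cd: "cd_le G 3" and e: "e \<in> hom (Zn_group 4) G"
  shows "\<not> inj_on e (carrier (Zn_group 4))"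
proof
  assume inj: "inj_on e (carrier (Zn_group 4))"
  let ?Z = "carrier (Zn_group 4)"
  have ec: "e v \<in> carrier G" if "v \<in> ?Z" for v using e that by (auto simp: hom_def)
  have ea: "e (\<lambda>i. v i + w i) = e v \<otimes> e w" if "v \<in> ?Z" "w \<in> ?Z" for v w
    using hom_mult[OF e that] by simp
  obtain r :: "'a \<Rightarrow> nat \<Rightarrow> int" where
    r: "\<And>v h. \<lbrakk>v \<in> ?Z; h \<in> carrier G\<rbrakk> \<Longrightarrow> r (e v \<otimes> h) = (\<lambda>i. v i + r h i)"
    using left_coset_coordinates[OF e inj] by blast
  \<comment> \<open>\<open>w\<close> is the pullback along \<open>r\<close> of the homogeneous cup product of the four coordinates;
    \<open>\<psi>\<close> evaluates it on the cone with apex \<open>\<one>\<close>, so that \<open>\<psi> (\<partial>z) = w z\<close>.\<close>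
  define w where "w hs = (\<Prod>i<4. r (hs ! Suc i) i - r (hs ! i) i)" for hs
  define \<psi> where "\<psi> = frag_extend (\<lambda>hs. frag_cmul (w (\<one> # hs)) (frag_of ()))"
  have \<psi>_add [simp]: "\<psi> (a + b) = \<psi> a + \<psi> b" "\<psi> (a - b) = \<psi> a - \<psi> b" "\<psi> (- a) = - \<psi> a" "\<psi> 0 = 0" for a b
    by (simp_all add: \<psi>_def frag_extend_add frag_extend_diff frag_extend_minus)
  have \<psi>_bd: "\<psi> (bar_boundary a b c d f) = frag_cmul (w [a,b,c,d,f]) (frag_of ())" for a b c d f
  proof -
    \<comment> \<open>The cocycle identity of the cup product \<open>w\<close> on the 5-simplex with
      vertices \<open>\<one>\<close>, \<open>a\<close>, \<open>b\<close>, \<open>c\<close>,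
      \<open>d\<close>, \<open>f\<close>.\<close>
    have "w [\<one>,b,c,d,f] - w [\<one>,a,c,d,f] + w [\<one>,a,b,d,f] - w [\<one>,a,b,c,f] + w [\<one>,a,b,c,d] = w [a,b,c,d,f]"
      by (simp add: w_def eval_nat_numeral) (simp add: algebra_simps)
    then show ?thesis
      by (simp add: bar_boundary_def \<psi>_def frag_extend_add frag_extend_diff
           flip: frag_cmul_distrib frag_cmul_diff_distrib)
  qed
  \<comment> \<open>Translation adds the same vector \<open>v\<close> to every value of
    \<open>r\<close>, and the differences in \<open>w\<close> cancel it.\<close>
  have w_shift: "w (map (\<lambda>x. e v \<otimes> x) [a,b,c,d,f]) = w [a,b,c,d,f]"
    if "v \<in> ?Z" "{a,b,c,d,f} \<subseteq> carrier G" for v a b c d f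
    using that by (simp add: w_def eval_nat_numeral r)
  \<comment> \<open>The largest submodule on which \<open>\<psi>\<close> is invariant under the copy of \<open>\<int>\<^sup>4\<close>;
    it replaces the image of the boundary map.\<close>
  define M where "M = {m. Poly_Mapping.keys m \<subseteq> lists (carrier G) \<and>
     (\<forall>h\<in>carrier G. \<forall>v\<in>?Z. \<psi> (bar_shift (e v) (bar_shift h m)) = \<psi> (bar_shift h m))}"
  have M_keys: "Poly_Mapping.keys m \<subseteq> lists (carrier G)" if "m \<in> M" for m
    using that by (simp add: M_def)
  have M_inv: "\<psi> (bar_shift (e v) m) = \<psi> m" if "m \<in> M" "v \<in> ?Z" for m v
    using that bar_shift_one[OF M_keys[OF that(1)]] unfolding M_def
    by (metis (mono_tags, lifting) mem_Collect_eq one_closed)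
  have module: "Gmodule G M bar_shift"
    unfolding Gmodule_def
  proof (intro conjI ballI)
    show "0 \<in> M" by (simp add: M_def)
    show "x + y \<in> M" if "x \<in> M" "y \<in> M" for x y
      using that order_trans[OF keys_add[of x y], of "lists (carrier G)"] by (simp add: M_def)
    show "- x \<in> M" if "x \<in> M" for x
      using that by (auto simp: M_def)
    show "bar_shift g x \<in> M" if g: "g \<in> carrier G" and x: "x \<in> M" for g x
    proof -
      have "\<psi> (bar_shift (e v) (bar_shift h (bar_shift g x))) = \<psi> (bar_shift h (bar_shift g x))"
        if "h \<in> carrier G" "v \<in> ?Z" for h v
        using x that g by (simp add: M_keys flip: bar_shift_mult[of x h g]) (simp add: M_def)
      then show ?thesis using keys_bar_shift[OF M_keys[OF x] g] by (simp add: M_def)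
    qed
    show "bar_shift (g \<otimes> h) x = bar_shift g (bar_shift h x)"
      if "g \<in> carrier G" "h \<in> carrier G" "x \<in> M" for g h x
      using bar_shift_mult[OF M_keys] that by blast
  qed (auto simp: M_keys bar_shift_one)
  have bd_M: "bar_boundary a b c d f \<in> M" if "{a,b,c,d,f} \<subseteq> carrier G" for a b c d f
  proof -
    have "Poly_Mapping.keys (bar_boundary a b c d f) \<subseteq> {[b,c,d,f],[a,c,d,f],[a,b,d,f],[a,b,c,f],[a,b,c,d]}"
      unfolding bar_boundary_def
      by (auto dest!: set_mp[OF keys_add] set_mp[OF keys_diff] simp: keys_frag_of)
    then have "Poly_Mapping.keys (bar_boundary a b c d f) \<subseteq> lists (carrier G)"
      by (rule order_trans) (use that in auto)
    then show ?thesis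
      using that w_shift by (auto simp: M_def bar_shift_boundary \<psi>_bd)
  qed
  have "bar_cocycle \<in> cochains G M 4"
    by (auto simp: cochains_def bar_cocycle_def tuples_def intro!: bd_M simp: subset_iff)
  moreover have "cohom_vanishes G M bar_shift 3"
    using cd module by (simp add: cd_le_def)
  ultimately obtain c where c: "c \<in> cochains G M 3"
    and cob: "\<And>gs. gs \<in> tuples G 4 \<Longrightarrow> bar_cocycle gs = coboundary G bar_shift 3 c gs"
    unfolding cohom_vanishes_def using coboundary_bar_cocycle by (auto simp: numeral_eq_Suc)
  have cM: "c [x,y,z] \<in> M" if "x \<in> carrier G" "y \<in> carrier G" "z \<in> carrier G" for x y z
    using c that by (auto simp: cochains_def tuples_def)
  \<comment> \<open>The values of \<open>\<psi>\<close> are multiples of the single generator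
    \<open>()\<close>, a copy of the integers on which \<open>frag_extend\<close> is available;
    \<open>lookup\<close> at \<open>()\<close> reads off the integer.\<close>
  define \<gamma> where "\<gamma> x y z = Poly_Mapping.lookup (\<psi> (c [e x, e y, e z])) ()" for x y z
  show False
  proof (rule cup_product_not_coboundary[of \<gamma>])
    fix v1 v2 v3 v4 assume v: "v1 \<in> ?Z" "v2 \<in> ?Z" "v3 \<in> ?Z" "v4 \<in> ?Z"
    have add: "(\<lambda>i. v i + w i) \<in> ?Z" if "v \<in> ?Z" "w \<in> ?Z" for v w using that by (auto simp: carrier_Zn_group)
    note ecv = ec[OF v(1)] ec[OF v(2)] ec[OF v(3)] ec[OF v(4)]
    note rv = r[OF v(1)] r[OF v(2)] r[OF v(3)] r[OF v(4)]
    have "w [\<one>, e v1, e v1 \<otimes> e v2, e v1 \<otimes> e v2 \<otimes> e v3, e v1 \<otimes> e v2 \<otimes> e v3 \<otimes> e v4] = v1 0 * v2 1 * v3 2 * v4 3"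
      using rv[OF one_closed] ecv by (simp add: w_def eval_nat_numeral rv m_assoc)
    moreover have "\<psi> (bar_cocycle [e v1, e v2, e v3, e v4]) =
      frag_cmul (w [\<one>, e v1, e v1 \<otimes> e v2, e v1 \<otimes> e v2 \<otimes> e v3, e v1 \<otimes> e v2 \<otimes> e v3 \<otimes> e v4]) (frag_of ())"
      by (simp add: bar_cocycle_def \<psi>_bd eval_nat_numeral)
    \<comment> \<open>Invariance of \<open>\<psi>\<close> on \<open>M\<close> removes the action
      from the first term of the coboundary of \<open>c\<close>, so the coefficients become
      trivial.\<close>
    moreover have "\<psi> (bar_cocycle [e v1, e v2, e v3, e v4]) =
      \<psi> (c [e v2, e v3, e v4]) - \<psi> (c [e v1 \<otimes> e v2, e v3, e v4]) + \<psi> (c [e v1, e v2 \<otimes> e v3, e v4])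
       - \<psi> (c [e v1, e v2, e v3 \<otimes> e v4]) + \<psi> (c [e v1, e v2, e v3])"
      using cob[of "[e v1, e v2, e v3, e v4]"] ecv v
      by (simp add: tuples_def coboundary_three M_inv cM)
    ultimately have "frag_cmul (v1 0 * v2 1 * v3 2 * v4 3) (frag_of ()) = 
      \<psi> (c [e v2, e v3, e v4]) - \<psi> (c [e v1 \<otimes> e v2, e v3, e v4]) + \<psi> (c [e v1, e v2 \<otimes> e v3, e v4])
       - \<psi> (c [e v1, e v2, e v3 \<otimes> e v4]) + \<psi> (c [e v1, e v2, e v3])"
      by simp
    then have "Poly_Mapping.lookup (frag_cmul (v1 0 * v2 1 * v3 2 * v4 3) (frag_of ())) () = Poly_Mapping.lookup (
      \<psi> (c [e v2, e v3, e v4]) - \<psi> (c [e v1 \<otimes> e v2, e v3, e v4]) + \<psi> (c [e v1, e v2 \<otimes> e v3, e v4])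
       - \<psi> (c [e v1, e v2, e v3 \<otimes> e v4]) + \<psi> (c [e v1, e v2, e v3])) ()"
      by simp
    then show "v1 0 * v2 1 * v3 2 * v4 3 = \<gamma> v2 v3 v4 - \<gamma> (\<lambda>i. v1 i + v2 i) v3 v4 + \<gamma> v1 (\<lambda>i. v2 i + v3 i) v4
        - \<gamma> v1 v2 (\<lambda>i. v3 i + v4 i) + \<gamma> v1 v2 v3"
      using v by (simp add: \<gamma>_def ea lookup_add lookup_minus)
  qed
qed

end

section \<open>Isometries of integral seminorms in rank three\<close>

locale Zn_endomorphism =
  fixes n :: nat and T :: "(nat \<Rightarrow> int) \<Rightarrow> nat \<Rightarrow> int"
  assumes T_closed: "v \<in> carrier (Zn_group n) \<Longrightarrow> T v \<in> carrier (Zn_group n)"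
    and T_add: "\<lbrakk>v \<in> carrier (Zn_group n); w \<in> carrier (Zn_group n)\<rbrakk> \<Longrightarrow>
      T (\<lambda>i. v i + w i) = (\<lambda>i. T v i + T w i)"
    and T_scale: "v \<in> carrier (Zn_group n) \<Longrightarrow> T (\<lambda>i. k * v i) = (\<lambda>i. k * T v i)"
begin

abbreviation V :: "(nat \<Rightarrow> int) set" where "V \<equiv> carrier (Zn_group n)"

lemma V_add: "u \<in> V \<Longrightarrow> w \<in> V \<Longrightarrow> (\<lambda>i. u i + w i) \<in> V"
  and V_scale: "w \<in> V \<Longrightarrow> (\<lambda>i. k * w i) \<in> V"
  and V_diff: "u \<in> V \<Longrightarrow> w \<in> V \<Longrightarrow> (\<lambda>i. u i - w i) \<in> V"
  by (simp_all add: carrier_Zn_group)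

lemma T_diff: "\<lbrakk>u \<in> V; w \<in> V\<rbrakk> \<Longrightarrow> T (\<lambda>i. u i - w i) = (\<lambda>i. T u i - T w i)"
  using T_add[OF _ V_scale, of u w "-1"] T_scale[of w "-1"] by simp

lemma T_expand:
  assumes v: "v \<in> V"
  shows "T v = (\<lambda>i. \<Sum>j<n. T (unit_vec j) i * v j)"
proof -
  have "T (\<lambda>i. if i < m then v i else 0) = (\<lambda>i. \<Sum>j<m. T (unit_vec j) i * v j)" if "m \<le> n" for m
    using that
  proof (induction m)
    case 0
    then show ?case using T_scale[OF v, of 0] by simp
  next
    case (Suc m)
    have u: "unit_vec m \<in> V" using Suc.prems by (simp add: unit_vec_in_Zn_group)
    have mem: "(\<lambda>i. if i < m then v i else 0) \<in> V" "(\<lambda>i. v m * unit_vec m i) \<in> V"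
      using v u by (auto simp: carrier_Zn_group)
    have "(\<lambda>i. if i < Suc m then v i else 0) = (\<lambda>i. (if i < m then v i else 0) + v m * unit_vec m i)"
      by (auto simp: unit_vec_def less_Suc_eq)
    then show ?case using T_add[OF mem] T_scale[OF u, of "v m"] Suc by (simp add: mult.commute)
  qed
  from this[of n] have "T (\<lambda>i. if i < n then v i else 0) = (\<lambda>i. \<Sum>j<n. T (unit_vec j) i * v j)" by simp
  moreover have "(\<lambda>i. if i < n then v i else 0) = v" using v by (auto simp: carrier_Zn_group)
  ultimately show ?thesis by simp
qed

text \<open>Padding by the identity matrix treats all ranks up to three at once.\<close>

definition padded_matrix :: "nat \<Rightarrow> nat \<Rightarrow> int" where
  "padded_matrix i j = (if i < n \<and> j < n then T (unit_vec j) i else if i = j then 1 else 0)"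

lemma T_eq_padded_matrix:
  assumes n: "n \<le> 3" and v: "v \<in> V"
  shows "T v i = padded_matrix i 0 * v 0 + padded_matrix i 1 * v 1 + padded_matrix i 2 * v 2"
proof -
  have "T v i = (\<Sum>j<3. padded_matrix i j * v j)"
  proof (cases "i < n")
    case True
    have "T v i = (\<Sum>j<n. T (unit_vec j) i * v j)"
      using T_expand[OF v] by simp
    also have "\<dots> = (\<Sum>j<n. padded_matrix i j * v j)"
      using True by (intro sum.cong) (auto simp: padded_matrix_def)
    also have "\<dots> = (\<Sum>j<3. padded_matrix i j * v j)"
      using n v by (intro sum.mono_neutral_left) (auto simp: carrier_Zn_group)
    finally show ?thesis .
  next
    case False
    have "padded_matrix i j * v j = 0" for j
      using False v by (auto simp: padded_matrix_def carrier_Zn_group)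
    then have "(\<Sum>j<3. padded_matrix i j * v j) = 0" by (intro sum.neutral) blast
    then show ?thesis using False T_closed[OF v] by (simp add: carrier_Zn_group)
  qed
  then show ?thesis by (simp add: eval_nat_numeral)
qed

end

text \<open>Depending on the signs, the bounds place \<open>t - s\<close> or \<open>t + s\<close>
  between -2 and 2. Modulo 9 these are 0 and 6, and 9 is the least modulus for which 6 is congruent
  to no number in that range.\<close>

lemma coefficients_eq_if_close:
  fixes s t :: int
  assumes "t mod 9 = 3" "s mod 9 = 3" "\<bar>t\<bar> \<le> \<bar>s\<bar> + 2" "\<bar>s\<bar> \<le> \<bar>t\<bar> + 2"
  shows "s = t"
proof -
  define p q where "p = t div 9" and "q = s div 9"
  have ts: "t = 9 * p + 3" "s = 9 * q + 3"
    using assms(1,2) unfolding p_def q_def by presburger+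
  show ?thesis
  proof (cases "p \<ge> 0"; cases "q \<ge> 0")
    assume "p \<ge> 0" "q \<ge> 0"
    then have "9 * p + 3 \<le> 9 * q + 5" "9 * q + 3 \<le> 9 * p + 5" using assms(3,4) unfolding ts by linarith+
    then have "p = q" by presburger
    then show ?thesis by (simp add: ts)
  next
    assume "\<not> p \<ge> 0" "\<not> q \<ge> 0"
    then have "- (9 * p + 3) \<le> 2 - (9 * q + 3)" "- (9 * q + 3) \<le> 2 - (9 * p + 3)"
      using assms(3,4) unfolding ts by linarith+
    then have "p = q" by presburger
    then show ?thesis by (simp add: ts)
  next
    assume "p \<ge> 0" "\<not> q \<ge> 0"
    then have "9 * p + 3 \<le> 2 - (9 * q + 3)" "- (9 * q + 3) \<le> 9 * p + 5"
      using assms(3,4) unfolding ts by linarith+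
    then show ?thesis by presburger
  next
    assume "\<not> p \<ge> 0" "q \<ge> 0"
    then have "9 * q + 3 \<le> 2 - (9 * p + 3)" "- (9 * p + 3) \<le> 9 * q + 5"
      using assms(3,4) unfolding ts by linarith+
    then show ?thesis by presburger
  qed
qed

section \<open>Endomorphisms that preserve a seminorm\<close>

locale Zn_seminorm_isometry = Zn_endomorphism +
  fixes L :: "(nat \<Rightarrow> int) \<Rightarrow> real"
  assumes L_nonneg: "v \<in> V \<Longrightarrow> L v \<ge> 0"
    and L_add: "v \<in> V \<Longrightarrow> w \<in> V \<Longrightarrow> L (\<lambda>i. v i + w i) \<le> L v + L w"
    and L_scale: "v \<in> V \<Longrightarrow> L (\<lambda>i. k * v i) = \<bar>real_of_int k\<bar> * L v"
    and L_T: "v \<in> V \<Longrightarrow> L (T v) = L v"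
begin

text \<open>Up to vectors of seminorm zero, the \<open>m\<close>-th iterate of \<open>T\<close>
  sends \<open>v\<close> to \<open>v + m * b\<close>. Its seminorm does not depend on
  \<open>m\<close>, so \<open>m * L b\<close> stays below \<open>2 * L v\<close>.\<close>

lemma unipotent_step:
  assumes v: "v \<in> V" and b: "b = (\<lambda>i. T v i - v i)" and c: "L (\<lambda>i. T b i - b i) = 0"
  shows "L b = 0"
proof (rule ccontr)
  assume "L b \<noteq> 0"
  have bV: "b \<in> V" using V_diff[OF T_closed[OF v] v] by (simp add: b)
  have pos: "L b > 0" using \<open>L b \<noteq> 0\<close> L_nonneg[OF bV] by simp
  define c where "c = (\<lambda>i. T b i - b i)"
  have cV: "c \<in> V" using V_diff[OF T_closed[OF bV] bV] by (simp add: c_def)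
  have Lc: "L c = 0" using c by (simp add: c_def)
  have Tv: "T v = (\<lambda>i. v i + b i)" by (simp add: b)
  have Tb: "T b = (\<lambda>i. b i + c i)" by (simp add: c_def)
  \<comment> \<open>\<open>d\<close> absorbs everything coming from iterates of \<open>c\<close>, in
    place of a binomial formula.\<close>
  have iter: "\<exists>d\<in>V. L d = 0 \<and> L (\<lambda>i. v i + int m * b i + d i) = L v" for m
  proof (induction m)
    case 0
    have "(\<lambda>i. 0) \<in> V" by (simp add: carrier_Zn_group)
    moreover have "L (\<lambda>i. 0) = 0" using L_scale[OF v, of 0] by simp
    ultimately show ?case by (intro bexI[of _ "\<lambda>i. 0"]) simp_all
  next
    case (Suc m)
    then obtain d where d: "d \<in> V" "L d = 0" "L (\<lambda>i. v i + int m * b i + d i) = L v" by blast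
    let ?d = "\<lambda>i. int m * c i + T d i"
    have dV: "?d \<in> V" using V_add[OF V_scale[OF cV] T_closed[OF d(1)]] .
    have "L ?d \<le> 0"
      using L_add[OF V_scale[OF cV] T_closed[OF d(1)], of "int m"] L_scale[OF cV] L_T[OF d(1)] Lc d(2)
      by simp
    then have "L ?d = 0" using L_nonneg[OF dV] by simp
    moreover have "T (\<lambda>i. v i + int m * b i + d i) = (\<lambda>i. v i + int (Suc m) * b i + ?d i)"
      unfolding T_add[OF V_add[OF v V_scale[OF bV]] d(1)] T_add[OF v V_scale[OF bV]] T_scale[OF bV]
        Tv Tb by (simp add: algebra_simps)
    ultimately show ?case
      using dV d(3) L_T[OF V_add[OF V_add[OF v V_scale[OF bV]] d(1)], of "int m"] by (intro bexI[of _ ?d]) simp_all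
  qed
  have bound: "real m * L b \<le> 2 * L v" for m
  proof -
    obtain d where d: "d \<in> V" "L d = 0" "L (\<lambda>i. v i + int m * b i + d i) = L v" using iter[of m] by blast
    let ?x = "\<lambda>i. v i + int m * b i + d i"
    have xV: "?x \<in> V" using V_add[OF V_add[OF v V_scale[OF bV]] d(1)] .
    have "(\<lambda>i. int m * b i) = (\<lambda>i. (?x i + (-1) * v i) + (-1) * d i)" by auto
    then have "real m * L b = L (\<lambda>i. (?x i + (-1) * v i) + (-1) * d i)"
      using L_scale[OF bV, of "int m"] by simp
    also have "\<dots> \<le> L ?x + L v + L d"
      using L_add[OF V_add[OF xV V_scale[OF v]] V_scale[OF d(1)], of "-1" "-1"]
        L_add[OF xV V_scale[OF v], of "-1"] L_scale[OF v, of "-1"] L_scale[OF d(1), of "-1"] by simp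
    finally show ?thesis using d by simp
  qed
  obtain m where "2 * L v < real m * L b"
    using reals_Archimedean3[OF pos] by blast
  then show False using bound[of m] by simp
qed

text \<open>On \<open>b\<close> the cubic relation and the triangle inequality bound the gap between
  the absolute values of \<open>s\<close> and \<open>t\<close> by 2, so \<open>s = t\<close>. Then 1
  is a root, the quadratic cofactor forces \<open>t = 3\<close>, and what remains is
  unipotent.\<close>

lemma invariant_cubic:
  assumes cubic: "\<And>v i. v \<in> V \<Longrightarrow> T (T (T v)) i - t * T (T v) i + s * T v i - v i = 0"
    and t: "t mod 9 = 3" and s: "s mod 9 = 3" and v: "v \<in> V"
  shows "L (\<lambda>i. T v i - v i) = 0"
proof (rule ccontr)
  define b where "b = (\<lambda>i. T v i - v i)"
  assume "L (\<lambda>i. T v i - v i) \<noteq> 0"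
  have L_comb: "\<bar>real_of_int k\<bar> * L x \<le> \<bar>real_of_int p\<bar> * L y + L z"
    if "x \<in> V" "y \<in> V" "z \<in> V" "\<And>i. k * x i = p * y i + z i" for k p x y z
    using L_add[OF V_scale[OF that(2)] that(3), of p] L_scale[OF that(1), of k] L_scale[OF that(2), of p] that(4)
    by simp
  have bV: "b \<in> V" using V_diff[OF T_closed[OF v] v] by (simp add: b_def)
  note TbV = T_closed[OF bV] T_closed[OF T_closed[OF bV]] T_closed[OF T_closed[OF T_closed[OF bV]]]
  have pos: "L b > 0"
    using \<open>L (\<lambda>i. T v i - v i) \<noteq> 0\<close> L_nonneg[OF bV] by (simp add: b_def)
  have LT: "L (T b) = L b" "L (T (T b)) = L b" "L (T (T (T b))) = L b"
    using L_T bV TbV by simp_all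
  have "L (\<lambda>i. T (T (T b)) i - b i) \<le> 2 * L b"
    using L_add[OF TbV(3) V_scale[OF bV, of "-1"]] L_scale[OF bV, of "-1"] LT by simp
  moreover have "\<bar>real_of_int t\<bar> * L (T (T b)) \<le> \<bar>real_of_int s\<bar> * L (T b) + L (\<lambda>i. T (T (T b)) i - b i)"
    by (rule L_comb) (use cubic[OF bV] TbV bV V_diff in \<open>auto simp: algebra_simps\<close>)
  moreover have "L (\<lambda>i. b i - T (T (T b)) i) \<le> 2 * L b"
    using L_add[OF bV V_scale[OF TbV(3), of "-1"]] L_scale[OF TbV(3), of "-1"] LT by simp
  moreover have "\<bar>real_of_int s\<bar> * L (T b) \<le> \<bar>real_of_int t\<bar> * L (T (T b)) + L (\<lambda>i. b i - T (T (T b)) i)"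
    by (rule L_comb) (use cubic[OF bV] TbV bV V_diff in \<open>auto simp: algebra_simps\<close>)
  ultimately have "\<bar>real_of_int t\<bar> * L b \<le> (\<bar>real_of_int s\<bar> + 2) * L b"
    "\<bar>real_of_int s\<bar> * L b \<le> (\<bar>real_of_int t\<bar> + 2) * L b"
    using LT by (auto simp: algebra_simps)
  then have "\<bar>t\<bar> \<le> \<bar>s\<bar> + 2" "\<bar>s\<bar> \<le> \<bar>t\<bar> + 2"
    using pos by (auto simp: mult_le_cancel_right)
  then have st: "s = t" using coefficients_eq_if_close t s by blast
  \<comment> \<open>For \<open>s = t\<close> the cubic factors as
    \<open>(X - 1) * (X\<^sup>2 + (1 - t) * X + 1)\<close>, and \<open>b\<close> is the image of
    \<open>v\<close> under the first factor.\<close>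
  have quadratic: "T (T b) i + (1 - t) * T b i + b i = 0" for i
    using cubic[OF v, of i] T_closed[OF v] T_closed[OF T_closed[OF v]] v
    by (simp add: b_def T_diff st algebra_simps)
  have "L (\<lambda>i. T (T b) i + b i) \<le> 2 * L b"
    using L_add[OF TbV(2) bV] LT by simp
  moreover have "\<bar>real_of_int (t - 1)\<bar> * L (T b) \<le> \<bar>real_of_int 0\<bar> * L b + L (\<lambda>i. T (T b) i + b i)"
    by (rule L_comb) (use TbV bV V_add quadratic in \<open>auto simp: algebra_simps\<close>)
  ultimately have "\<bar>real_of_int (t - 1)\<bar> * L b \<le> 2 * L b" using LT by simp
  then have "\<bar>real_of_int (t - 1)\<bar> \<le> 2" using pos by (simp add: mult_le_cancel_right)
  then have "\<bar>t - 1\<bar> \<le> 2" by linarith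
  then have "t = 3" using t by presburger
  \<comment> \<open>For \<open>t = 3\<close> the quadratic is \<open>(X - 1)\<^sup>2\<close>, so
    \<open>T\<close> fixes \<open>c\<close>. Two uses of \<open>unipotent_step\<close> then descend
    to \<open>L c = 0\<close> and to \<open>L b = 0\<close>.\<close>
  define c where "c = (\<lambda>i. T b i - b i)"
  have cV: "c \<in> V" using V_diff[OF TbV(1) bV] by (simp add: c_def)
  have "T c = c"
    using quadratic bV TbV by (auto simp: c_def T_diff \<open>t = 3\<close> algebra_simps)
  then have "L (\<lambda>i. T c i - c i) = 0" using L_scale[OF v, of 0] by simp
  then have "L c = 0" using unipotent_step[OF bV c_def] by simp
  then have "L b = 0" using unipotent_step[OF v b_def] by (simp add: c_def)
  then show False using pos by simp
qed

end

section \<open>Characteristic polynomials of integral 3 by 3 matrices\<close>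

definition det3 :: "(nat \<Rightarrow> nat \<Rightarrow> int) \<Rightarrow> int" where
  "det3 M = M 0 0 * (M 1 1 * M 2 2 - M 1 2 * M 2 1) - M 0 1 * (M 1 0 * M 2 2 - M 1 2 * M 2 0)
     + M 0 2 * (M 1 0 * M 2 1 - M 1 1 * M 2 0)"

definition trace3 :: "(nat \<Rightarrow> nat \<Rightarrow> int) \<Rightarrow> int" where
  "trace3 M = M 0 0 + M 1 1 + M 2 2"

definition minors3 :: "(nat \<Rightarrow> nat \<Rightarrow> int) \<Rightarrow> int" where
  "minors3 M = (M 0 0 * M 1 1 - M 0 1 * M 1 0) + (M 0 0 * M 2 2 - M 0 2 * M 2 0)
     + (M 1 1 * M 2 2 - M 1 2 * M 2 1)"

lemma det3_mult:
  "det3 M * det3 N = det3 (\<lambda>i j. M i 0 * N 0 j + M i 1 * N 1 j + M i 2 * N 2 j)"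
  by (simp add: det3_def algebra_simps)

lemma cayley_hamilton3:
  fixes M :: "nat \<Rightarrow> nat \<Rightarrow> int"
  assumes "i < 3"
    and w: "\<And>i. i < 3 \<Longrightarrow> w i = M i 0 * v 0 + M i 1 * v 1 + M i 2 * v 2"
    and x: "\<And>i. i < 3 \<Longrightarrow> x i = M i 0 * w 0 + M i 1 * w 1 + M i 2 * w 2"
    and y: "\<And>i. i < 3 \<Longrightarrow> y i = M i 0 * x 0 + M i 1 * x 1 + M i 2 * x 2"
  shows "y i - trace3 M * x i + minors3 M * w i - det3 M * v i = 0"
proof -
  have "i = 0 \<or> i = 1 \<or> i = 2" using assms(1) by auto
  then show ?thesis
    using w[of 0] w[of 1] w[of 2] x[of 0] x[of 1] x[of 2] y[of 0] y[of 1] y[of 2]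
    by (elim disjE) (simp_all add: trace3_def minors3_def det3_def algebra_simps)
qed

text \<open>Writing the matrix as identity plus \<open>9 * B\<close> shows that its characteristic
  polynomial is congruent to \<open>(X - 1)\<^sup>3\<close> modulo 9.\<close>

lemma principal_minors_mod_nine:
  fixes M :: "nat \<Rightarrow> nat \<Rightarrow> int"
  assumes "\<And>i j. 9 dvd M i j - (if i = j then 1 else 0)"
  shows "trace3 M mod 9 = 3" "minors3 M mod 9 = 3" "det3 M mod 9 = 1"
proof -
  obtain B where B: "\<And>i j. M i j = (if i = j then 1 else 0) + 9 * B i j"
    using assms unfolding dvd_def by (metis (no_types) add.commute diff_add_cancel)
  have mod9: "x mod 9 = c mod 9" if "x = c + 9 * y" for x y c :: int using that by presburger
  have "trace3 M = 3 + 9 * trace3 B" by (simp add: trace3_def B)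
  from mod9[OF this] show "trace3 M mod 9 = 3" by simp
  have "minors3 M = 3 + 9 * (2 * trace3 B + 9 * minors3 B)"
    by (simp add: trace3_def minors3_def B algebra_simps)
  from mod9[OF this] show "minors3 M mod 9 = 3" by simp
  have "det3 M = 1 + 9 * (trace3 B + 9 * minors3 B + 81 * det3 B)"
    by (simp add: trace3_def minors3_def det3_def B algebra_simps)
  from mod9[OF this] show "det3 M mod 9 = 1" by simp
qed

text \<open>Cayley-Hamilton for the padded matrix. The right inverse \<open>S\<close> makes its
  determinant a unit, and the congruence modulo 9 selects 1 rather than -1.\<close>

lemma (in Zn_endomorphism) cubic_relation:
  assumes n: "n \<le> 3"
    and S: "Zn_endomorphism n S" and TS: "\<And>v. v \<in> V \<Longrightarrow> T (S v) = v"
    and cong: "\<And>i j. i < n \<Longrightarrow> j < n \<Longrightarrow> 9 dvd T (unit_vec j) i - unit_vec j i"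
  shows "\<exists>t s. t mod 9 = 3 \<and> s mod 9 = 3 \<and>
    (\<forall>v\<in>V. \<forall>i. T (T (T v)) i - t * T (T v) i + s * T v i - v i = 0)"
proof -
  interpret S: Zn_endomorphism n S by (rule S)
  let ?M = "padded_matrix" and ?N = "S.padded_matrix"
  note app = T_eq_padded_matrix[OF n] and S_closed = S.T_closed
  have M9: "9 dvd ?M i j - (if i = j then 1 else 0)" for i j
    using cong[of i j] by (auto simp: padded_matrix_def unit_vec_def)
  \<comment> \<open>For \<open>j < n\<close> column \<open>j\<close> of the product is
    \<open>T (S (unit_vec j))\<close>; the other columns are padding in both factors.\<close>
  have MN: "?M i 0 * ?N 0 j + ?M i 1 * ?N 1 j + ?M i 2 * ?N 2 j = (if i = j then 1 else 0)"
    if "i < 3" "j < 3" for i j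
  proof (cases "j < n")
    case True
    have u: "unit_vec j \<in> V" using True by (simp add: unit_vec_in_Zn_group)
    have N: "?N k j = S (unit_vec j) k" for k
      using True S_closed[OF u] by (auto simp: S.padded_matrix_def carrier_Zn_group)
    show ?thesis
      using app[OF S_closed[OF u], of i] TS[OF u] by (simp add: N unit_vec_def)
  next
    case False
    then have N: "?N k j = (if k = j then 1 else 0)" "?M i j = (if i = j then 1 else 0)" for k
      by (auto simp: padded_matrix_def S.padded_matrix_def)
    have "j = 0 \<or> j = 1 \<or> j = 2" using that by auto
    then show ?thesis using N(1)[of 0] N(1)[of 1] N(1)[of 2] N(2) by (elim disjE) simp_all
  qed
  have "det3 ?M * det3 ?N = 1"
    unfolding det3_mult by (simp add: det3_def MN del: One_nat_def)
  have one: "x = 1" if "x dvd 1" "x mod 9 = 1" for x :: int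
    using that unfolding zdvd1_eq by presburger
  from \<open>det3 ?M * det3 ?N = 1\<close> have "det3 ?M dvd 1" by (metis dvd_triv_left)
  then have det: "det3 ?M = 1"
    using principal_minors_mod_nine(3)[OF M9] one by simp
  have "T (T (T v)) i - trace3 ?M * T (T v) i + minors3 ?M * T v i - v i = 0" if v: "v \<in> V" for v i
  proof (cases "i < 3")
    case True
    have "T (T (T v)) i - trace3 ?M * T (T v) i + minors3 ?M * T v i - det3 ?M * v i = 0"
      by (rule cayley_hamilton3[OF True, where w = "T v" and x = "T (T v)" and y = "T (T (T v))"])
        (rule app T_closed v)+
    then show ?thesis by (simp add: det)
  next
    case False
    then show ?thesis using v T_closed n by (auto simp: carrier_Zn_group)
  qed
  then show ?thesis using principal_minors_mod_nine[OF M9] by blast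
qed

section \<open>Finite index\<close>

text \<open>\<open>C\<close> need not be contained in \<open>E\<close>.\<close>

definition finite_index :: "('g, 'b) monoid_scheme \<Rightarrow> 'g set \<Rightarrow> 'g set \<Rightarrow> bool" where
  "finite_index G E C \<longleftrightarrow> finite ((\<lambda>x. C #>\<^bsub>G\<^esub> x) ` E)"

definition normalizes :: "('g, 'b) monoid_scheme \<Rightarrow> 'g set \<Rightarrow> 'g set \<Rightarrow> bool" where
  "normalizes G H N \<longleftrightarrow> (\<forall>h\<in>H. \<forall>x\<in>N. h \<otimes>\<^bsub>G\<^esub> x \<otimes>\<^bsub>G\<^esub> inv\<^bsub>G\<^esub> h \<in> N)"

text \<open>The elements of \<open>E\<close> whose conjugation action fixes every coset of
  \<open>B\<close> in \<open>D\<close>, as membership of the commutator in \<open>B\<close> means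
  that \<open>d\<close> and its conjugate have the same right coset.\<close>

definition trivial_mod :: "('g, 'b) monoid_scheme \<Rightarrow> 'g set \<Rightarrow> 'g set \<Rightarrow> 'g set \<Rightarrow> 'g set" where
  "trivial_mod G E D B =
    {x \<in> E. \<forall>d\<in>D. x \<otimes>\<^bsub>G\<^esub> d \<otimes>\<^bsub>G\<^esub> inv\<^bsub>G\<^esub> x \<otimes>\<^bsub>G\<^esub> inv\<^bsub>G\<^esub> d \<in> B}"

context group
begin

lemma inv_cancel_left:
  "x \<in> carrier G \<Longrightarrow> y \<in> carrier G \<Longrightarrow> x \<otimes> (inv x \<otimes> y) = y"
  "x \<in> carrier G \<Longrightarrow> y \<in> carrier G \<Longrightarrow> inv x \<otimes> (x \<otimes> y) = y"
  by (simp_all add: m_assoc[symmetric])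

lemmas group_normalize = m_assoc inv_mult_group inv_cancel_left

lemma r_coset_eq_iff:
  assumes C: "subgroup C G" and x: "x \<in> carrier G" and y: "y \<in> carrier G"
  shows "C #> x = C #> y \<longleftrightarrow> x \<otimes> inv y \<in> C"
proof
  assume "C #> x = C #> y"
  then have "x \<in> C #> y" using rcos_self[OF x C] by simp
  then show "x \<otimes> inv y \<in> C" by (rule subgroup.rcos_module_imp[OF C group_axioms y])
next
  assume "x \<otimes> inv y \<in> C"
  then have "x \<in> C #> y" by (rule subgroup.rcos_module_rev[OF C group_axioms y x])
  then show "C #> x = C #> y" using repr_independence[OF _ y C] by simp
qed

text \<open>The coset of \<open>x\<close> can be recovered from \<open>f x\<close> by choosing any
  element of \<open>E\<close> with the same value, so there are at most as many cosets as
  values.\<close>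

lemma finite_indexI:
  assumes C: "subgroup C G" and E: "E \<subseteq> carrier G" and fin: "finite (f ` E)"
    and f: "\<And>x y. \<lbrakk>x \<in> E; y \<in> E; f x = f y\<rbrakk> \<Longrightarrow> x \<otimes> inv y \<in> C"
  shows "finite_index G E C"
proof -
  define g where "g z = C #> (SOME x. x \<in> E \<and> f x = z)" for z
  have "C #> x = g (f x)" if x: "x \<in> E" for x
  proof -
    define y where "y = (SOME y. y \<in> E \<and> f y = f x)"
    have "x \<in> E \<and> f x = f x" using x by simp
    then have y: "y \<in> E \<and> f y = f x" unfolding y_def by (rule someI)
    then have "y \<otimes> inv x \<in> C" using f x by simp
    moreover have "y \<in> carrier G" "x \<in> carrier G" using x y E by auto
    ultimately have "C #> y = C #> x" using r_coset_eq_iff[OF C] by simp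
    then show ?thesis by (simp add: g_def y_def)
  qed
  then have "(\<lambda>x. C #> x) ` E \<subseteq> g ` f ` E" by blast
  then show ?thesis unfolding finite_index_def using fin finite_subset by blast
qed

lemma finite_index_Int:
  assumes "subgroup B G" "subgroup C G" "E \<subseteq> carrier G" "finite_index G E B" "finite_index G E C"
  shows "finite_index G E (B \<inter> C)"
proof (rule finite_indexI[where f = "\<lambda>x. (B #> x, C #> x)"])
  have "(\<lambda>x. (B #> x, C #> x)) ` E \<subseteq> ((\<lambda>x. B #> x) ` E) \<times> ((\<lambda>x. C #> x) ` E)" by auto
  moreover have "finite (((\<lambda>x. B #> x) ` E) \<times> ((\<lambda>x. C #> x) ` E))"
    using assms(4,5) unfolding finite_index_def by (rule finite_cartesian_product)
  ultimately show "finite ((\<lambda>x. (B #> x, C #> x)) ` E)" by (rule finite_subset)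
  fix x y assume xy: "x \<in> E" "y \<in> E" "(B #> x, C #> x) = (B #> y, C #> y)"
  then have c: "x \<in> carrier G" "y \<in> carrier G" using assms(3) by blast+
  show "x \<otimes> inv y \<in> B \<inter> C"
    using xy(3) r_coset_eq_iff[OF assms(1) c] r_coset_eq_iff[OF assms(2) c] by simp
qed (rule subgroups_Inter_pair assms)+

text \<open>Each \<open>x\<close> in \<open>E\<close> is an element of \<open>D\<close> times the
  chosen representative of its \<open>D\<close>-coset. The \<open>D\<close>-coset of
  \<open>x\<close> and the \<open>C\<close>-coset of that first factor together form a finite-valued
  separating map.\<close>

lemma finite_index_trans:
  assumes C: "subgroup C G" and D: "subgroup D G" and E: "E \<subseteq> carrier G"
    and DC: "finite_index G D C" and ED: "finite_index G E D"
  shows "finite_index G E C"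
proof -
  define r where "r K = (SOME x. x \<in> E \<and> D #> x = K)" for K
  have r: "r (D #> x) \<in> E" "D #> r (D #> x) = D #> x" if "x \<in> E" for x
  proof -
    have "x \<in> E \<and> D #> x = D #> x" using that by simp
    then have "r (D #> x) \<in> E \<and> D #> r (D #> x) = D #> x" unfolding r_def by (rule someI)
    then show "r (D #> x) \<in> E" "D #> r (D #> x) = D #> x" by simp_all
  qed
  have rD: "x \<otimes> inv (r (D #> x)) \<in> D" if "x \<in> E" for x
  proof -
    have "x \<in> carrier G" "r (D #> x) \<in> carrier G" using r(1)[OF that] that E by blast+
    then show ?thesis using r(2)[OF that] r_coset_eq_iff[OF D, of x "r (D #> x)"] by simp
  qed
  show ?thesis
  proof (rule finite_indexI[OF C E, where f = "\<lambda>x. (D #> x, C #> (x \<otimes> inv (r (D #> x))))"])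
    have "(\<lambda>x. (D #> x, C #> (x \<otimes> inv (r (D #> x))))) ` E \<subseteq> ((\<lambda>x. D #> x) ` E) \<times> ((\<lambda>x. C #> x) ` D)"
      using rD by (intro image_subsetI) simp
    moreover have "finite (((\<lambda>x. D #> x) ` E) \<times> ((\<lambda>x. C #> x) ` D))"
      using ED DC unfolding finite_index_def by (rule finite_cartesian_product)
    ultimately show "finite ((\<lambda>x. (D #> x, C #> (x \<otimes> inv (r (D #> x))))) ` E)" by (rule finite_subset)
  next
    fix x y assume xy: "x \<in> E" "y \<in> E" "(D #> x, C #> (x \<otimes> inv (r (D #> x)))) = (D #> y, C #> (y \<otimes> inv (r (D #> y))))"
    let ?z = "r (D #> x)"
    have c: "x \<in> carrier G" "y \<in> carrier G" "?z \<in> carrier G" using xy r E by auto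
    have eqs: "D #> x = D #> y" "C #> (x \<otimes> inv ?z) = C #> (y \<otimes> inv (r (D #> y)))" using xy(3) by blast+
    then have "C #> (x \<otimes> inv ?z) = C #> (y \<otimes> inv ?z)" by (simp only: eqs(1))
    then have "(x \<otimes> inv ?z) \<otimes> inv (y \<otimes> inv ?z) \<in> C" using r_coset_eq_iff[OF C, of "x \<otimes> inv ?z" "y \<otimes> inv ?z"] c by simp
    then show "x \<otimes> inv y \<in> C" using c by (simp add: group_normalize)
  qed
qed

lemma normalizes_subset: "normalizes G H N \<Longrightarrow> K \<subseteq> H \<Longrightarrow> normalizes G K N"
  by (auto simp: normalizes_def)

lemma normalizesD:
  "normalizes G H N \<Longrightarrow> h \<in> H \<Longrightarrow> x \<in> N \<Longrightarrow> h \<otimes> x \<otimes> inv h \<in> N"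
  by (simp add: normalizes_def)

lemma normalizesD':
  assumes "normalizes G H N" "subgroup H G" "h \<in> H" "x \<in> N"
  shows "inv h \<otimes> x \<otimes> h \<in> N"
  using normalizesD[OF assms(1) subgroup.m_inv_closed[OF assms(2,3)] assms(4)] assms
  by (simp add: subgroup.mem_carrier)

section \<open>Kernels of conjugation actions on cosets\<close>

context
  fixes E D B
  assumes E: "subgroup E G" and D: "subgroup D G" and B: "subgroup B G" and BD: "B \<subseteq> D"
    and ED: "normalizes G E D" and EB: "normalizes G E B"
begin

interpretation E: subgroup E G by (rule E)
interpretation D: subgroup D G by (rule D)
interpretation B: subgroup B G by (rule B)

lemma subgroup_trivial_mod: "subgroup (trivial_mod G E D B) G"
proof (rule subgroupI)
  show "trivial_mod G E D B \<subseteq> carrier G" by (auto simp: trivial_mod_def)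
  have "\<one> \<in> trivial_mod G E D B" by (simp add: trivial_mod_def)
  then show "trivial_mod G E D B \<noteq> {}" by blast
next
  fix x assume x: "x \<in> trivial_mod G E D B"
  then have xE: "x \<in> E" by (simp add: trivial_mod_def)
  have "inv x \<otimes> d \<otimes> inv (inv x) \<otimes> inv d \<in> B" if d: "d \<in> D" for d
  proof -
    let ?e = "inv x \<otimes> d \<otimes> x"
    have e: "?e \<in> D" by (rule normalizesD'[OF ED E xE d])
    then have "inv (x \<otimes> ?e \<otimes> inv x \<otimes> inv ?e) \<in> B" using x by (simp add: trivial_mod_def)
    then show ?thesis using xE d by (simp add: group_normalize)
  qed
  then show "inv x \<in> trivial_mod G E D B" using xE by (simp add: trivial_mod_def)
next
  fix x y assume x: "x \<in> trivial_mod G E D B" and y: "y \<in> trivial_mod G E D B"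
  then have xE: "x \<in> E" "y \<in> E" by (simp_all add: trivial_mod_def)
  have "x \<otimes> y \<otimes> d \<otimes> inv (x \<otimes> y) \<otimes> inv d \<in> B" if d: "d \<in> D" for d
  proof -
    let ?e = "y \<otimes> d \<otimes> inv y"
    have e: "?e \<in> D" by (rule normalizesD[OF ED xE(2) d])
    have "x \<otimes> ?e \<otimes> inv x \<otimes> inv ?e \<in> B" "?e \<otimes> inv d \<in> B"
      using x y e d unfolding trivial_mod_def by blast+
    then have "(x \<otimes> ?e \<otimes> inv x \<otimes> inv ?e) \<otimes> (?e \<otimes> inv d) \<in> B"
      by (rule B.m_closed)
    then show ?thesis using xE d by (simp add: group_normalize)
  qed
  then show "x \<otimes> y \<in> trivial_mod G E D B" using xE by (simp add: trivial_mod_def)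
qed

text \<open>The kernel of an action on a finite set has finite index: \<open>f x\<close> records
  where finitely many coset representatives go.\<close>

lemma finite_index_trivial_mod:
  assumes fin: "finite_index G D B"
  shows "finite_index G E (trivial_mod G E D B)"
proof -
  obtain R where R: "finite R" "R \<subseteq> D" "(\<lambda>d. B #> d) ` D = (\<lambda>d. B #> d) ` R"
    using finite_subset_image[OF fin[unfolded finite_index_def] subset_refl] by metis
  \<comment> \<open>Conjugation by \<open>inv x\<close> matches the right cosets: equal values put
    \<open>x \<otimes> inv y\<close>, not \<open>inv y \<otimes> x\<close>, in the kernel.\<close>
  define f where "f x = (\<lambda>r\<in>R. B #> (inv x \<otimes> r \<otimes> x))" for x
  show ?thesis
  proof (rule finite_indexI[OF subgroup_trivial_mod E.subset, where f = f])
    have "f ` E \<subseteq> (\<Pi>\<^sub>E r\<in>R. (\<lambda>d. B #> d) ` D)"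
    proof (intro image_subsetI PiE_I)
      fix x r assume "x \<in> E" "r \<in> R"
      then have "inv x \<otimes> r \<otimes> x \<in> D" using normalizesD'[OF ED E] R(2) by blast
      then show "f x r \<in> (\<lambda>d. B #> d) ` D" using \<open>r \<in> R\<close> by (simp add: f_def)
    qed (simp add: f_def)
    moreover have "finite (\<Pi>\<^sub>E r\<in>R. (\<lambda>d. B #> d) ` D)"
      using R(1) fin unfolding finite_index_def by (rule finite_PiE)
    ultimately show "finite (f ` E)" by (rule finite_subset)
  next
    fix x y assume x: "x \<in> E" and y: "y \<in> E" and eq: "f x = f y"
    have "x \<otimes> inv y \<otimes> d \<otimes> inv (x \<otimes> inv y) \<otimes> inv d \<in> B" if d: "d \<in> D" for d
    proof -
      obtain r where r: "r \<in> R" "B #> d = B #> r" using R(3) d by blast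
      then have rD: "r \<in> D" using R(2) by blast
      have b: "d \<otimes> inv r \<in> B" using r(2) r_coset_eq_iff[OF B] d rD by simp
      have "B #> (inv x \<otimes> r \<otimes> x) = B #> (inv y \<otimes> r \<otimes> y)"
        using fun_cong[OF eq, of r] r(1) by (simp add: f_def)
      then have "(inv x \<otimes> r \<otimes> x) \<otimes> inv (inv y \<otimes> r \<otimes> y) \<in> B"
        using r_coset_eq_iff[OF B, of "inv x \<otimes> r \<otimes> x" "inv y \<otimes> r \<otimes> y"] x y rD by simp
      \<comment> \<open>Since \<open>E\<close> normalizes \<open>B\<close>, conjugates of
        \<open>d\<close> and of its representative \<open>r\<close> stay in one coset, which extends
        the equality from \<open>r\<close> to \<open>d\<close>.\<close>
      moreover have "inv x \<otimes> (d \<otimes> inv r) \<otimes> x \<in> B" "inv y \<otimes> (d \<otimes> inv r) \<otimes> y \<in> B"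
        using normalizesD'[OF EB E] b x y by blast+
      ultimately have "(inv x \<otimes> (d \<otimes> inv r) \<otimes> x) \<otimes> ((inv x \<otimes> r \<otimes> x) \<otimes> inv (inv y \<otimes> r \<otimes> y))
          \<otimes> inv (inv y \<otimes> (d \<otimes> inv r) \<otimes> y) \<in> B" by simp
      then have "inv x \<otimes> d \<otimes> x \<otimes> inv y \<otimes> inv d \<otimes> y \<in> B"
        using x y d rD by (simp add: group_normalize)
      then have "inv (inv x \<otimes> d \<otimes> x \<otimes> inv y \<otimes> inv d \<otimes> y) \<in> B" by simp
      from normalizesD[OF EB x this] show ?thesis
        using x y d by (simp add: group_normalize)
    qed
    then show "x \<otimes> inv y \<in> trivial_mod G E D B" using x y by (simp add: trivial_mod_def)
  qed
qed

lemma normalizes_trivial_mod: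
  assumes H: "subgroup H G" and HE: "normalizes G H E" and HD: "normalizes G H D" and HB: "normalizes G H B"
  shows "normalizes G H (trivial_mod G E D B)"
  unfolding normalizes_def
proof (intro ballI)
  fix h x assume h: "h \<in> H" and x: "x \<in> trivial_mod G E D B"
  then have xE: "x \<in> E" and hc: "h \<in> carrier G" using subgroup.mem_carrier[OF H] by (auto simp: trivial_mod_def)
  have "h \<otimes> x \<otimes> inv h \<otimes> d \<otimes> inv (h \<otimes> x \<otimes> inv h) \<otimes> inv d \<in> B" if d: "d \<in> D" for d
  proof -
    let ?e = "inv h \<otimes> d \<otimes> h"
    have e: "?e \<in> D" by (rule normalizesD'[OF HD H h d])
    then have "x \<otimes> ?e \<otimes> inv x \<otimes> inv ?e \<in> B" using x by (simp add: trivial_mod_def)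
    from normalizesD[OF HB h this] show ?thesis using hc xE d by (simp add: group_normalize)
  qed
  then show "h \<otimes> x \<otimes> inv h \<in> trivial_mod G E D B"
    using normalizesD[OF HE h xE] by (simp add: trivial_mod_def)
qed

end

end

section \<open>Solvable groups with a length function\<close>

lemma hom_imp_Zn_endomorphism:
  assumes "T \<in> hom (Zn_group n) (Zn_group n)"
  shows "Zn_endomorphism n T"
proof
  fix v w :: "nat \<Rightarrow> int" and k :: int
  assume v: "v \<in> carrier (Zn_group n)"
  show Tv: "T v \<in> carrier (Zn_group n)" using hom_in_carrier[OF assms v] .
  show "T (\<lambda>i. k * v i) = (\<lambda>i. k * T v i)"
    using hom_int_pow[OF assms v group_Zn_group group_Zn_group, of k] v Tv
    by (simp add: int_pow_Zn_group)
  show "T (\<lambda>i. v i + w i) = (\<lambda>i. T v i + T w i)" if "w \<in> carrier (Zn_group n)"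
    using hom_mult[OF assms v that] by simp
qed

locale length_group = group G for G :: "('g, 'b) monoid_scheme" (structure) +
  fixes l :: "'g \<Rightarrow> real"
  assumes length: "length_function G l"
begin

lemma length_nonneg: "g \<in> carrier G \<Longrightarrow> l g \<ge> 0"
  and length_int_pow: "g \<in> carrier G \<Longrightarrow> l (g [^] (k::int)) = \<bar>real_of_int k\<bar> * l g"
  and length_conj: "g \<in> carrier G \<Longrightarrow> h \<in> carrier G \<Longrightarrow> l (h \<otimes> g \<otimes> inv h) = l g"
  and length_mult_le: "\<lbrakk>g \<in> carrier G; h \<in> carrier G; g \<otimes> h = h \<otimes> g\<rbrakk> \<Longrightarrow> l (g \<otimes> h) \<le> l g + l h"
  using length unfolding length_function_def by blast+

lemma length_nat_pow: "g \<in> carrier G \<Longrightarrow> l (g [^] (k::nat)) = real k * l g"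
  using length_int_pow[of g "int k"] by (simp add: int_pow_int)

lemma length_inv: "g \<in> carrier G \<Longrightarrow> l (inv g) = l g"
  using length_int_pow[of g "-1"] int_pow_neg[of g 1] by simp

text \<open>Conjugating \<open>y\<close> by \<open>x\<close> repeatedly gives \<open>d ^ n * y\<close>, of constant length.\<close>

lemma central_commutator_length_zero:
  assumes x: "x \<in> carrier G" and y: "y \<in> carrier G" and d: "d \<in> carrier G"
    and eq: "x \<otimes> y = d \<otimes> y \<otimes> x" and dx: "d \<otimes> x = x \<otimes> d" and dy: "d \<otimes> y = y \<otimes> d"
  shows "l d = 0"
proof -
  have dn: "d [^] (n::nat) \<in> carrier G" for n using d by simp
  have dnx: "d [^] (n::nat) \<otimes> x = x \<otimes> d [^] n" for n
    by (rule group_commutes_pow[OF dx d x])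
  have dny: "d [^] (n::nat) \<otimes> y = y \<otimes> d [^] n" for n
    by (rule group_commutes_pow[OF dy d y])
  have len: "l (d [^] (n::nat) \<otimes> y) = l y" for n
  proof (induction n)
    case 0
    then show ?case using y by simp
  next
    case (Suc n)
    have "x \<otimes> (d [^] n \<otimes> y) \<otimes> inv x = d [^] n \<otimes> (x \<otimes> y) \<otimes> inv x"
      using x y dn[of n] dnx[of n] by (simp flip: m_assoc)
    also have "\<dots> = d [^] Suc n \<otimes> y"
      using x y d dn[of n] by (simp add: eq m_assoc)
    finally show ?case using length_conj[of "d [^] n \<otimes> y" x] x y dn[of n] Suc by simp
  qed
  have "real n * l d \<le> 2 * l y" for n
  proof -
    have c: "d [^] n \<otimes> y \<otimes> inv y = d [^] n" using y dn[of n] by (simp add: m_assoc)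
    have "inv y \<otimes> (d [^] n \<otimes> y) = d [^] n" using dny[of n] y dn[of n] by (simp add: inv_cancel_left)
    then have "l (d [^] n \<otimes> y \<otimes> inv y) \<le> l (d [^] n \<otimes> y) + l (inv y)"
      using c y dn[of n] by (intro length_mult_le) auto
    then show ?thesis using c len[of n] length_inv[OF y] length_nat_pow[OF d, of n] by simp
  qed
  then show ?thesis
    using reals_Archimedean3[of "l d"] length_nonneg[OF d] by (metis leD order_le_less)
qed

text \<open>In coordinates, conjugation by \<open>x\<close> is an invertible integral matrix
  congruent to the identity modulo 9, and it preserves the seminorm \<open>l \<circ> F\<close>. By
  \<open>invariant_cubic\<close> it moves each vector by one of length zero, and \<open>pos\<close>
  makes that displacement trivial.\<close>

lemma trivial_mod_nine_centralizes:
  assumes A: "subgroup A G" and F: "F \<in> iso (Zn_group n) (G\<lparr>carrier := A\<rparr>)" and n: "n \<le> 3"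
    and pos: "\<And>a. a \<in> A \<Longrightarrow> l a = 0 \<Longrightarrow> a = \<one>"
    and x: "x \<in> carrier G" and conj: "\<And>a. a \<in> A \<Longrightarrow> x \<otimes> a \<otimes> inv x \<in> A"
    and conj': "\<And>a. a \<in> A \<Longrightarrow> inv x \<otimes> a \<otimes> x \<in> A"
    and nine: "\<And>a. a \<in> A \<Longrightarrow> \<exists>b\<in>A. x \<otimes> a \<otimes> inv x \<otimes> inv a = b [^] (9::int)"
    and a: "a \<in> A"
  shows "x \<otimes> a = a \<otimes> x"
proof -
  let ?K = "G\<lparr>carrier := A\<rparr>" and ?V = "carrier (Zn_group n)"
  interpret A: subgroup A G by (rule A)
  define Fi where "Fi = inv_into ?V F"
  have K: "group ?K" by (rule subgroup_imp_group[OF A])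
  have Fhom: "F \<in> hom (Zn_group n) ?K" and bij: "bij_betw F ?V A"
    using F by (auto simp: iso_def)
  have Fihom: "Fi \<in> hom ?K (Zn_group n)"
    using group.iso_set_sym[OF group_Zn_group F] by (simp add: Fi_def iso_def)
  have FA: "F v \<in> A" if "v \<in> ?V" for v using hom_in_carrier[OF Fhom that] by simp
  have Fadd: "F (\<lambda>i. v i + w i) = F v \<otimes> F w" if "v \<in> ?V" "w \<in> ?V" for v w
    using hom_mult[OF Fhom that] by simp
  have Fscale: "F (\<lambda>i. k * v i) = F v [^] k" if "v \<in> ?V" for v k
    using hom_int_pow[OF Fhom that group_Zn_group K, of k] int_pow_consistent[OF A FA[OF that], of k]
      int_pow_Zn_group[OF that, of k] by simp
  have FFi: "F (Fi b) = b" if "b \<in> A" for b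
    using bij that by (simp add: Fi_def bij_betw_inv_into_right)
  have FiF: "Fi (F v) = v" if "v \<in> ?V" for v
    using bij that by (simp add: Fi_def bij_betw_inv_into_left)
  have endo: "Zn_endomorphism n (\<lambda>v. Fi (g \<otimes> F v \<otimes> inv g))"
    if g: "g \<in> carrier G" and gA: "\<And>a. a \<in> A \<Longrightarrow> g \<otimes> a \<otimes> inv g \<in> A" for g
  proof (rule hom_imp_Zn_endomorphism)
    have "(\<lambda>a. g \<otimes> a \<otimes> inv g) \<in> hom ?K ?K"
      using g gA by (intro homI) (simp_all add: group_normalize)
    from Group.hom_compose[OF Group.hom_compose[OF Fhom this] Fihom]
    show "(\<lambda>v. Fi (g \<otimes> F v \<otimes> inv g)) \<in> hom (Zn_group n) (Zn_group n)" by (simp add: comp_def)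
  qed
  define T where "T = (\<lambda>v. Fi (x \<otimes> F v \<otimes> inv x))"
  define S where "S = (\<lambda>v. Fi (inv x \<otimes> F v \<otimes> x))"
  have Sendo: "Zn_endomorphism n S" using endo[of "inv x"] x conj' by (simp add: S_def)
  interpret T: Zn_endomorphism n T using endo[OF x conj] by (simp add: T_def)
  have FT: "F (T v) = x \<otimes> F v \<otimes> inv x" if "v \<in> ?V" for v
    unfolding T_def by (rule FFi[OF conj[OF FA[OF that]]])
  have FS: "F (S v) = inv x \<otimes> F v \<otimes> x" if "v \<in> ?V" for v
    unfolding S_def by (rule FFi[OF conj'[OF FA[OF that]]])
  have TS: "T (S v) = v" if v: "v \<in> ?V" for v
  proof -
    have SV: "S v \<in> ?V" using Sendo v by (simp add: Zn_endomorphism_def)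
    have "F (T (S v)) = F v"
      unfolding FT[OF SV] FS[OF v] using x FA[OF v] by (simp add: group_normalize)
    then show ?thesis using FiF[OF v] FiF[OF T.T_closed[OF SV]] by metis
  qed
  \<comment> \<open>A ninth power in \<open>A\<close> has all its coordinates divisible by 9, so
    \<open>nine\<close> becomes a congruence of matrix columns.\<close>
  have cong: "9 dvd T (unit_vec j) i - unit_vec j i" if "j < n" for i j
  proof -
    have u: "unit_vec j \<in> ?V" using that by (rule unit_vec_in_Zn_group)
    obtain b where b: "b \<in> A" "x \<otimes> F (unit_vec j) \<otimes> inv x \<otimes> inv (F (unit_vec j)) = b [^] (9::int)"
      using nine[OF FA[OF u]] by blast
    have w: "Fi b \<in> ?V" "(\<lambda>i. 9 * Fi b i) \<in> ?V"
      using hom_in_carrier[OF Fihom] b(1) T.V_scale by simp_all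
    have "F (T (unit_vec j)) = b [^] (9::int) \<otimes> F (unit_vec j)"
      unfolding FT[OF u] b(2)[symmetric] using x FA[OF u] by (simp add: group_normalize)
    also have "\<dots> = F (\<lambda>i. 9 * Fi b i + unit_vec j i)"
      using Fadd[OF w(2) u] Fscale[OF w(1), of 9] FFi[OF b(1)] by simp
    finally have "T (unit_vec j) = (\<lambda>i. 9 * Fi b i + unit_vec j i)"
      using FiF[OF T.T_closed[OF u]] FiF[OF T.V_add[OF w(2) u]] by metis
    then show ?thesis by simp
  qed
  obtain t s where ts: "t mod 9 = 3" "s mod 9 = 3"
    "\<forall>v\<in>?V. \<forall>i. T (T (T v)) i - t * T (T v) i + s * T v i - v i = 0"
    using T.cubic_relation[OF n Sendo TS cong] by blast
  interpret L: Zn_seminorm_isometry n T "\<lambda>v. l (F v)"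
  proof
    fix v w :: "nat \<Rightarrow> int" and k :: int
    assume v: "v \<in> ?V"
    show "0 \<le> l (F v)" using length_nonneg FA[OF v] by simp
    show "l (F (\<lambda>i. k * v i)) = \<bar>real_of_int k\<bar> * l (F v)"
      using Fscale[OF v] length_int_pow FA[OF v] by simp
    show "l (F (T v)) = l (F v)" using FT[OF v] length_conj x FA[OF v] by simp
    show "l (F (\<lambda>i. v i + w i)) \<le> l (F v) + l (F w)" if w: "w \<in> ?V"
    proof -
      have "F v \<otimes> F w = F w \<otimes> F v"
        unfolding Fadd[OF v w, symmetric] Fadd[OF w v, symmetric] by (simp add: add.commute)
      then show ?thesis using Fadd[OF v w] length_mult_le FA[OF v] FA[OF w] by simp
    qed
  qed
  let ?v = "Fi a"
  have v: "?v \<in> ?V" using hom_in_carrier[OF Fihom] a by simp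
  have dV: "(\<lambda>i. T ?v i - ?v i) \<in> ?V" by (rule T.V_diff[OF T.T_closed[OF v] v])
  have "l (F (\<lambda>i. T ?v i - ?v i)) = 0"
    using L.invariant_cubic[of t s, OF _ ts(1,2) v] ts(3) by blast
  then have "F (\<lambda>i. T ?v i - ?v i) = \<one>" using pos FA[OF dV] by blast
  moreover have "F (T ?v) = F (\<lambda>i. T ?v i - ?v i) \<otimes> F ?v" using Fadd[OF dV v] by simp
  ultimately have "x \<otimes> a \<otimes> inv x = a" using FT[OF v] FFi[OF a] a by simp
  then have "x \<otimes> a \<otimes> inv x \<otimes> x = a \<otimes> x" by simp
  then show ?thesis using x a by (simp add: m_assoc)
qed

end

section \<open>Powers in a free abelian subgroup\<close>

lemma (in group) nth_powers_subgroup: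
  assumes A: "subgroup A G" and comm: "\<And>a b. a \<in> A \<Longrightarrow> b \<in> A \<Longrightarrow> a \<otimes> b = b \<otimes> a"
  shows "subgroup {a [^] (k::int) |a. a \<in> A} G"
proof -
  interpret A: subgroup A G by (rule A)
  show ?thesis
  proof (rule subgroupI)
    show "{a [^] k |a. a \<in> A} \<noteq> {}" using A.one_closed by blast
    show "{a [^] k |a. a \<in> A} \<subseteq> carrier G" by auto
  next
    fix y assume "y \<in> {a [^] k |a. a \<in> A}"
    then obtain a where a: "a \<in> A" "y = a [^] k" by blast
    then have "inv y = inv a [^] k" by (simp add: int_pow_inv)
    then show "inv y \<in> {a [^] k |a. a \<in> A}" using a by blast
  next
    fix y z assume "y \<in> {a [^] k |a. a \<in> A}" "z \<in> {a [^] k |a. a \<in> A}"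
    then obtain a b where ab: "a \<in> A" "y = a [^] k" "b \<in> A" "z = b [^] k" by blast
    then have "y \<otimes> z = (a \<otimes> b) [^] k" using int_pow_mult_distrib[OF comm, of a b k] by simp
    then show "y \<otimes> z \<in> {a [^] k |a. a \<in> A}" using ab by blast
  qed
qed

lemma (in group) nth_powers_normalized:
  assumes H: "H \<subseteq> carrier G" and A: "subgroup A G" and HA: "normalizes G H A"
  shows "normalizes G H {a [^] (k::int) |a. a \<in> A}"
  unfolding normalizes_def
proof (intro ballI)
  fix h y assume h: "h \<in> H" and "y \<in> {a [^] k |a. a \<in> A}"
  then obtain a where a: "a \<in> A" "y = a [^] k" by blast
  have c: "h \<in> carrier G" "a \<in> carrier G" using h H a subgroup.mem_carrier[OF A] by auto
  have "(\<lambda>a. h \<otimes> a \<otimes> inv h) \<in> hom G G"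
    using c(1) by (intro homI) (simp_all add: group_normalize)
  from hom_int_pow[OF this c(2) group_axioms group_axioms, of k]
  have "h \<otimes> y \<otimes> inv h = (h \<otimes> a \<otimes> inv h) [^] k" using a by simp
  then show "h \<otimes> y \<otimes> inv h \<in> {a [^] k |a. a \<in> A}" using normalizesD[OF HA h a(1)] by blast
qed

text \<open>The coordinates modulo \<open>k\<close> take finitely many values and separate the
  cosets.\<close>

lemma (in group) finite_index_nth_powers:
  assumes A: "subgroup A G" and F: "F \<in> iso (Zn_group n) (G\<lparr>carrier := A\<rparr>)" and k: "k > 0"
    and comm: "\<And>a b. a \<in> A \<Longrightarrow> b \<in> A \<Longrightarrow> a \<otimes> b = b \<otimes> a"
  shows "finite_index G A {a [^] (k::int) |a. a \<in> A}"
proof -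
  let ?K = "G\<lparr>carrier := A\<rparr>" and ?V = "carrier (Zn_group n)"
  interpret A: subgroup A G by (rule A)
  have K: "group ?K" by (rule subgroup_imp_group[OF A])
  have Fhom: "F \<in> hom (Zn_group n) ?K" and bij: "bij_betw F ?V A"
    using F by (auto simp: iso_def)
  define Fi where "Fi = inv_into ?V F"
  have Fi: "Fi b \<in> ?V" "F (Fi b) = b" if "b \<in> A" for b
    using bij that by (auto simp: Fi_def bij_betw_inv_into_right bij_betw_def inv_into_into)
  define f where "f a = (\<lambda>i\<in>{..<n}. Fi a i mod k)" for a
  show ?thesis
  proof (rule finite_indexI[OF nth_powers_subgroup[OF A comm] A.subset, where f = f])
    have "f ` A \<subseteq> ({..<n} \<rightarrow>\<^sub>E {0..<k})" using k by (intro image_subsetI PiE_I) (auto simp: f_def)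
    moreover have "finite ({..<n} \<rightarrow>\<^sub>E {0..<k})" by (intro finite_PiE) auto
    ultimately show "finite (f ` A)" by (rule finite_subset)
  next
    fix x y assume x: "x \<in> A" and y: "y \<in> A" and eq: "f x = f y"
    define w where "w i = (Fi x i - Fi y i) div k" for i
    have "k * w i = Fi x i - Fi y i" for i
    proof (cases "i < n")
      case True
      then have "Fi x i mod k = Fi y i mod k" using fun_cong[OF eq, of i] by (simp add: f_def)
      then have "k dvd Fi x i - Fi y i" by (simp add: mod_eq_dvd_iff)
      then show ?thesis by (simp add: w_def)
    next
      case False
      then show ?thesis using Fi(1)[OF x] Fi(1)[OF y] by (simp add: w_def carrier_Zn_group)
    qed
    then have e: "Fi x = (\<lambda>i. k * w i + Fi y i)" by simp
    have w: "w \<in> ?V" using Fi(1)[OF x] Fi(1)[OF y] by (simp add: w_def carrier_Zn_group)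
    then have kw: "(\<lambda>i. k * w i) \<in> ?V" by (simp add: carrier_Zn_group)
    have Fw: "F w \<in> A" using hom_in_carrier[OF Fhom w] by simp
    have "x = F (\<lambda>i. k * w i) \<otimes> y"
      using hom_mult[OF Fhom kw Fi(1)[OF y]] Fi(2)[OF x] Fi(2)[OF y] e by simp
    also have "F (\<lambda>i. k * w i) = F w [^] k"
      using hom_int_pow[OF Fhom w group_Zn_group K, of k] int_pow_consistent[OF A Fw, of k]
        int_pow_Zn_group[OF w, of k] by simp
    finally have "x \<otimes> inv y = F w [^] k" using y Fw by (simp add: m_assoc)
    then show "x \<otimes> inv y \<in> {a [^] k |a. a \<in> A}" using Fw by blast
  qed simp_all
qed


text \<open>Normalization by all of \<open>H\<close>, not only by \<open>D\<close>, lets the next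
  larger term of the series act on \<open>A\<close> by conjugation.\<close>

definition virtually_abelian_in :: "('g, 'b) monoid_scheme \<Rightarrow> 'g set \<Rightarrow> 'g set \<Rightarrow> bool" where
  "virtually_abelian_in G H D \<longleftrightarrow>
    (\<exists>A. subgroup A G \<and> A \<subseteq> D \<and> (\<forall>a\<in>A. \<forall>b\<in>A. a \<otimes>\<^bsub>G\<^esub> b = b \<otimes>\<^bsub>G\<^esub> a) \<and>
      normalizes G H A \<and> finite_index G D A)"

text \<open>\<open>C\<close> centralizes \<open>A\<close> and acts trivially on the cosets of
  \<open>A\<close> in \<open>D\<close>. Commutators of \<open>C\<close> with
  \<open>C \<inter> D\<close> lie in \<open>A\<close>, hence commute with \<open>C\<close> and
  vanish by the length argument. Commutators within \<open>C\<close> lie in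
  \<open>C \<inter> D\<close>, so they now commute with \<open>C\<close> and vanish
  likewise.\<close>

lemma (in length_group) virtually_abelian_extend:
  assumes H: "subgroup H G" and pos: "\<And>h. h \<in> H \<Longrightarrow> l h = 0 \<Longrightarrow> h = \<one>"
    and rank: "\<And>A. \<lbrakk>subgroup A G; A \<subseteq> H; \<And>a b. a \<in> A \<Longrightarrow> b \<in> A \<Longrightarrow> a \<otimes> b = b \<otimes> a\<rbrakk> \<Longrightarrow>
        \<exists>n\<le>3. \<exists>F. F \<in> iso (Zn_group n) (G\<lparr>carrier := A\<rparr>)"
    and D: "subgroup D G" and E: "subgroup E G" and DE: "D \<subseteq> E" and EH: "E \<subseteq> H"
    and HD: "normalizes G H D" and HE: "normalizes G H E"
    and comm: "\<And>x y. x \<in> E \<Longrightarrow> y \<in> E \<Longrightarrow> x \<otimes> y \<otimes> inv x \<otimes> inv y \<in> D"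
    and va: "virtually_abelian_in G H D"
  shows "virtually_abelian_in G H E"
proof -
  obtain A where A: "subgroup A G" and AD: "A \<subseteq> D" and HA: "normalizes G H A" and DA: "finite_index G D A"
    and Acomm: "\<And>a b. a \<in> A \<Longrightarrow> b \<in> A \<Longrightarrow> a \<otimes> b = b \<otimes> a"
    using va unfolding virtually_abelian_in_def by blast
  obtain n F where n: "n \<le> 3" and F: "F \<in> iso (Zn_group n) (G\<lparr>carrier := A\<rparr>)"
    using rank[OF A _ Acomm] AD DE EH by blast
  interpret H: subgroup H G by (rule H)
  interpret E: subgroup E G by (rule E)
  interpret D: subgroup D G by (rule D)
  interpret A: subgroup A G by (rule A)
  define A9 where "A9 = {a [^] (9::int) |a. a \<in> A}"
  have A9: "subgroup A9 G" unfolding A9_def by (rule nth_powers_subgroup[OF A Acomm])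
  have A9A: "A9 \<subseteq> A" using subgroup_int_pow_closed[OF A] by (auto simp: A9_def)
  have HA9: "normalizes G H A9" unfolding A9_def by (rule nth_powers_normalized[OF H.subset A HA])
  have AA9: "finite_index G A A9" unfolding A9_def by (rule finite_index_nth_powers[OF A F _ Acomm]) simp
  note En = normalizes_subset[OF _ EH]
  note K1 = E D A AD En[OF HD] En[OF HA] and K2 = E A A9 A9A En[OF HA] En[OF HA9]
  \<comment> \<open>The first factor puts commutators of \<open>C\<close> with \<open>D\<close> in
    \<open>A\<close>; the second makes \<open>C\<close> act on \<open>A\<close> by matrices
    congruent to the identity modulo 9.\<close>
  define C where "C = trivial_mod G E D A \<inter> trivial_mod G E A A9"
  have C: "subgroup C G"
    unfolding C_def by (rule subgroups_Inter_pair[OF subgroup_trivial_mod[OF K1] subgroup_trivial_mod[OF K2]])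
  interpret C: subgroup C G by (rule C)
  have fin: "finite_index G E C"
    unfolding C_def
    by (rule finite_index_Int[OF subgroup_trivial_mod[OF K1] subgroup_trivial_mod[OF K2] E.subset
          finite_index_trivial_mod[OF K1 DA] finite_index_trivial_mod[OF K2 AA9]])
  have HC: "normalizes G H C"
    using normalizes_trivial_mod[OF K1 H HE HD HA] normalizes_trivial_mod[OF K2 H HE HA HA9]
    unfolding C_def normalizes_def by blast
  have CE: "C \<subseteq> E" by (auto simp: C_def trivial_mod_def)
  have central: "x \<otimes> a = a \<otimes> x" if x: "x \<in> C" and a: "a \<in> A" for x a
  proof (rule trivial_mod_nine_centralizes[OF A F n _ _ _ _ _ a])
    have xH: "x \<in> H" using x CE EH by blast
    show "x \<in> carrier G" using xH by simp
    show "b = \<one>" if "b \<in> A" "l b = 0" for b using pos that AD DE EH by blast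
    show "x \<otimes> b \<otimes> inv x \<in> A" if "b \<in> A" for b by (rule normalizesD[OF HA xH that])
    show "inv x \<otimes> b \<otimes> x \<in> A" if "b \<in> A" for b by (rule normalizesD'[OF HA H xH that])
    show "\<exists>c\<in>A. x \<otimes> b \<otimes> inv x \<otimes> inv b = c [^] (9::int)" if "b \<in> A" for b
      using x that unfolding C_def trivial_mod_def A9_def by blast
  qed
  have commutator_trivial: "d = \<one>"
    if "x \<in> C" "y \<in> C" "d \<in> C" "d = x \<otimes> y \<otimes> inv x \<otimes> inv y" "d \<otimes> x = x \<otimes> d" "d \<otimes> y = y \<otimes> d" for x y d
  proof -
    have "x \<otimes> y = d \<otimes> y \<otimes> x" using that(1,2) unfolding that(4) by (simp add: group_normalize)
    then have "l d = 0" using that by (intro central_commutator_length_zero[of x y d]) simp_all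
    then show ?thesis using pos that(3) CE EH by blast
  qed
  have commute_if: "x \<otimes> y = y \<otimes> x"
    if "x \<in> C" "y \<in> C" "x \<otimes> y \<otimes> inv x \<otimes> inv y = \<one>" for x y
  proof -
    have "x \<otimes> y = (x \<otimes> y \<otimes> inv x \<otimes> inv y) \<otimes> (y \<otimes> x)"
      using that(1,2) by (simp add: group_normalize)
    then show ?thesis using that by simp
  qed
  have CD: "x \<otimes> d = d \<otimes> x" if x: "x \<in> C" and d: "d \<in> C" "d \<in> D" for x d
  proof -
    let ?a = "x \<otimes> d \<otimes> inv x \<otimes> inv d"
    have a: "?a \<in> A" using x d(2) by (simp add: C_def trivial_mod_def)
    have "?a = \<one>"
      by (rule commutator_trivial[OF x d(1) _ refl central[OF x a, symmetric] central[OF d(1) a, symmetric]])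
        (use x d(1) in simp)
    with commute_if[of x d] x d(1) show ?thesis by blast
  qed
  have "x \<otimes> y = y \<otimes> x" if x: "x \<in> C" and y: "y \<in> C" for x y
  proof -
    let ?d = "x \<otimes> y \<otimes> inv x \<otimes> inv y"
    have d: "?d \<in> C" "?d \<in> D" using x y CE comm by auto
    have "?d = \<one>"
      by (rule commutator_trivial[OF x y d(1) refl CD[OF x d, symmetric] CD[OF y d, symmetric]])
    with commute_if[of x y] x y show ?thesis by blast
  qed
  then show ?thesis unfolding virtually_abelian_in_def using C CE HC fin by blast
qed

section \<open>Climbing the derived series\<close>

lemma (in group) derived_series_normal: "(derived G ^^ i) (carrier G) \<lhd> G"
  by (induction i) (simp_all add: normal_self derived_is_normal)

lemma (in length_group) solvable_virtually_abelian:
  assumes solv: "solvable G" and H: "subgroup H G" and pos: "\<And>h. h \<in> H \<Longrightarrow> l h = 0 \<Longrightarrow> h = \<one>"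
    and rank: "\<And>A. \<lbrakk>subgroup A G; A \<subseteq> H; \<And>a b. a \<in> A \<Longrightarrow> b \<in> A \<Longrightarrow> a \<otimes> b = b \<otimes> a\<rbrakk> \<Longrightarrow>
        \<exists>n\<le>3. \<exists>F. F \<in> iso (Zn_group n) (G\<lparr>carrier := A\<rparr>)"
  shows "virtually_abelian_in G H H"
proof -
  \<comment> \<open>Intersecting the derived series of \<open>G\<close> with \<open>H\<close> keeps
    every term normalized by \<open>H\<close> and inside the set where \<open>pos\<close>
    applies.\<close>
  define D where "D i = (derived G ^^ i) (carrier G) \<inter> H" for i
  have normal: "(derived G ^^ i) (carrier G) \<lhd> G" for i by (rule derived_series_normal)
  have sub: "subgroup (D i) G" for i
    unfolding D_def by (rule subgroups_Inter_pair[OF normal_imp_subgroup[OF normal] H])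
  have HD: "normalizes G H (D i)" for i
    unfolding normalizes_def
  proof (intro ballI)
    fix h x assume h: "h \<in> H" and x: "x \<in> D i"
    then have "h \<otimes> x \<otimes> inv h \<in> (derived G ^^ i) (carrier G)"
      using normal.inv_op_closed2[OF normal subgroup.mem_carrier[OF H h]] by (simp add: D_def)
    moreover have "h \<otimes> x \<otimes> inv h \<in> H"
      using h x H by (simp add: D_def subgroup.m_closed subgroup.m_inv_closed)
    ultimately show "h \<otimes> x \<otimes> inv h \<in> D i" by (simp add: D_def)
  qed
  have comm: "x \<otimes> y \<otimes> inv x \<otimes> inv y \<in> D (Suc i)" if "x \<in> D i" "y \<in> D i" for x y i
  proof -
    have "x \<otimes> y \<otimes> inv x \<otimes> inv y \<in> derived_set G ((derived G ^^ i) (carrier G))"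
      using that by (auto simp: D_def)
    then have "x \<otimes> y \<otimes> inv x \<otimes> inv y \<in> (derived G ^^ Suc i) (carrier G)"
      by (simp add: derived_def generate.incl)
    moreover have "x \<otimes> y \<otimes> inv x \<otimes> inv y \<in> H"
      using that H by (simp add: D_def subgroup.m_closed subgroup.m_inv_closed)
    ultimately show ?thesis by (simp add: D_def)
  qed
  have anti: "D (Suc i) \<subseteq> D i" for i
  proof -
    have "derived G ((derived G ^^ i) (carrier G)) \<subseteq> (derived G ^^ i) (carrier G)"
      by (rule derived_incl[OF subset_refl normal_imp_subgroup[OF normal]])
    then show ?thesis by (auto simp: D_def)
  qed
  obtain N where "(derived G ^^ N) (carrier G) = {\<one>}"
    using solvable_imp_trivial_derived_seq solv unfolding solvable_def by blast
  then have DN: "D N = {\<one>}" using subgroup.one_closed[OF H] by (auto simp: D_def)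
  have "finite_index G {\<one>} {\<one>}" by (simp add: finite_index_def)
  then have base: "virtually_abelian_in G H (D N)"
    unfolding virtually_abelian_in_def DN using HD[of N] sub[of N]
    by (intro exI[of _ "{\<one>}"]) (simp add: DN)
  \<comment> \<open>Induction upwards from the trivial term \<open>D N\<close> to
    \<open>D 0\<close>, which equals \<open>H\<close>.\<close>
  have "virtually_abelian_in G H (D (N - k))" if "k \<le> N" for k
    using that
  proof (induction k)
    case 0
    then show ?case using base by simp
  next
    case (Suc k)
    then have eq: "N - k = Suc (N - Suc k)" by simp
    have va: "virtually_abelian_in G H (D (Suc (N - Suc k)))" using Suc eq by simp
    show ?case
      by (rule virtually_abelian_extend[OF H pos rank sub sub anti _ HD HD comm va]) (auto simp: D_def)
  qed
  from this[of N] show ?thesis using subgroup.subset[OF H] by (simp add: D_def Int_absorb1)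
qed

lemma torsion_free_subgroup:
  assumes "torsion_free (G\<lparr>carrier := H\<rparr>)" "A \<subseteq> H"
  shows "torsion_free (G\<lparr>carrier := A\<rparr>)"
  using assms unfolding torsion_free_def infinite_order_def nat_pow_def by auto

text \<open>In rank above 3 the first four coordinates would embed Z^4 in \<open>H\<close>. The
  dimension bound is applied to \<open>H\<close> itself, so it does not have to be passed down to
  \<open>A\<close>.\<close>

lemma (in group) abelian_subgroup_iso_Zn:
  assumes H: "subgroup H G" and tf: "torsion_free (G\<lparr>carrier := H\<rparr>)"
    and cd: "cd_le (G\<lparr>carrier := H\<rparr>) 3" and fg: "abelian_subgroups_fg G"
    and A: "subgroup A G" and AH: "A \<subseteq> H" and comm: "\<And>a b. a \<in> A \<Longrightarrow> b \<in> A \<Longrightarrow> a \<otimes> b = b \<otimes> a"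
  shows "\<exists>n\<le>3. \<exists>F. F \<in> iso (Zn_group n) (G\<lparr>carrier := A\<rparr>)"
proof -
  let ?K = "G\<lparr>carrier := A\<rparr>"
  obtain S where S: "finite S" "S \<subseteq> A" "generate G S = A"
    using fg A comm unfolding abelian_subgroups_fg_def by metis
  interpret K: comm_group ?K
    using group.group_comm_groupI[OF subgroup_imp_group[OF A]] comm by simp
  have "generate ?K S = carrier ?K" using generate_consistent[OF S(2) A] S(3) by simp
  then obtain n F where F: "F \<in> iso (Zn_group n) ?K"
    using K.fg_torsion_free_iso_Zn[OF torsion_free_subgroup[OF tf AH] S(1)] S(2) by auto
  have "n \<le> 3"
  proof (rule ccontr)
    assume "\<not> n \<le> 3"
    \<comment> \<open>Vectors are functions on all naturals vanishing from the rank on, so the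
      smaller group is literally a subset and \<open>F\<close> itself restricts.\<close>
    then have sub: "carrier (Zn_group 4) \<subseteq> carrier (Zn_group n)" by (auto simp: carrier_Zn_group)
    have Fhom: "F \<in> hom (Zn_group n) ?K" and inj: "inj_on F (carrier (Zn_group n))"
      using F by (auto simp: iso_def bij_betw_def)
    have "F \<in> hom (Zn_group 4) (G\<lparr>carrier := H\<rparr>)"
    proof (rule homI)
      fix v w assume "v \<in> carrier (Zn_group 4)" "w \<in> carrier (Zn_group 4)"
      then show "F (v \<otimes>\<^bsub>Zn_group 4\<^esub> w) = F v \<otimes>\<^bsub>G\<lparr>carrier := H\<rparr>\<^esub> F w"
        using hom_mult[OF Fhom, of v w] sub by auto
    qed (use hom_in_carrier[OF Fhom] sub AH in auto)
    then show False
      using group.cd_le_three_imp_no_Z4[OF subgroup_imp_group[OF H] cd] inj_on_subset[OF inj sub] by blast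
  qed
  then show ?thesis using F by blast
qed

theorem theorem19:
  fixes G :: "('g, 'b) monoid_scheme" and l :: "'g \<Rightarrow> real"
  assumes "group G"
    and "solvable G"
    and "length_function G l"
    and "purely_positive G l"
    and "vcd_le G 3"
    and "abelian_subgroups_fg G"
  shows "\<exists>H n. subgroup H G \<and> finite (rcosets\<^bsub>G\<^esub> H) \<and> n \<le> 3 \<and>
                G\<lparr>carrier := H\<rparr> \<cong> Zn_group n"
proof -
  interpret length_group G l
    using assms(1,3) by (simp add: length_group_def length_group_axioms_def)
  obtain H where H: "subgroup H G" and fin: "finite (rcosets\<^bsub>G\<^esub> H)"
    and tf: "torsion_free (G\<lparr>carrier := H\<rparr>)" and cd: "cd_le (G\<lparr>carrier := H\<rparr>) 3"
    using assms(5) unfolding vcd_le_def by blast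
  \<comment> \<open>Torsion-freeness of \<open>H\<close> turns positivity on elements of infinite
    order into positivity off the identity.\<close>
  have pos: "h = \<one>\<^bsub>G\<^esub>" if "h \<in> H" "l h = 0" for h
  proof (rule ccontr)
    assume "h \<noteq> \<one>\<^bsub>G\<^esub>"
    then have "infinite_order G h"
      using tf that(1) unfolding torsion_free_def infinite_order_def nat_pow_def by simp
    then show False
      using assms(4) that subgroup.mem_carrier[OF H] unfolding purely_positive_def by force
  qed
  note rank = abelian_subgroup_iso_Zn[OF H tf cd assms(6)]
  \<comment> \<open>The final witness is \<open>A\<close>, of finite index in the torsion-free
    subgroup \<open>H\<close> and hence in \<open>G\<close>.\<close>
  obtain A where A: "subgroup A G" "A \<subseteq> H" "finite_index G H A"
    and comm: "\<And>a b. a \<in> A \<Longrightarrow> b \<in> A \<Longrightarrow> a \<otimes>\<^bsub>G\<^esub> b = b \<otimes>\<^bsub>G\<^esub> a"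
    using solvable_virtually_abelian[OF assms(2) H pos rank] unfolding virtually_abelian_in_def by blast
  obtain n F where n: "n \<le> 3" and F: "F \<in> iso (Zn_group n) (G\<lparr>carrier := A\<rparr>)"
    using rank[OF A(1,2) comm] by blast
  have rcosets: "rcosets\<^bsub>G\<^esub> B = (\<lambda>x. B #>\<^bsub>G\<^esub> x) ` carrier G" for B
    by (auto simp: RCOSETS_def)
  have "finite_index G (carrier G) H" using fin by (simp add: finite_index_def rcosets)
  then have "finite_index G (carrier G) A"
    using finite_index_trans[OF A(1) H subset_refl A(3)] by blast
  then have "finite (rcosets\<^bsub>G\<^esub> A)" by (simp add: finite_index_def rcosets)
  moreover have "G\<lparr>carrier := A\<rparr> \<cong> Zn_group n"
    using group.iso_set_sym[OF group_Zn_group F] unfolding is_iso_def by blast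
  ultimately show ?thesis using A(1) n by blast
qed

end
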